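(* Let $H$ be a finitely generated subgroup of $G=\mathbb{Z}^m\times F_n$, let $\pi\colon G\to F_n$ be the natural projection, and let $L_H=H\cap\mathbb{Z}^m$. (i) If $\mathrm r(H\pi)\leqslant 1$, then $\mathrm{di}_G(H)=1$. (ii) If $\mathrm r(H\pi)\geqslant 2$ and $[\mathbb{Z}^m:L_H]=\infty$, then $\mathrm{di}_G(H)=\infty$. (iii) If $\mathrm r(H\pi)\geqslant 2$ and $[\mathbb{Z}^m:L_H]=l<\infty$, then $\mathrm{di}_G(H)\leqslant l\cdot\mathrm{di}_{F_n}(H\pi)$.
   Context: $F_n$ is the free group of rank $n$. For a group $G$, $\mathrm r(G)$ is the rank (minimum cardinality of a generating set) and $\tilde{\mathrm r}(G)=\max\{0,\mathrm r(G)-1\}$ is the reduced rank. Arguments of maps are written on the left, so $H\pi$ is the image of $H$ under $\pi$. For a finitely generated subgroup $H$ of a group $G$, the degree of inertia of $H$ in $G$ is $\mathrm{di}_G(H)=\sup_K\{\tilde{\mathrm r}(H\cap K)/\tilde{\mathrm r}(K)\}$, where $K$ runs over all finitely generated subgroups of $G$ such that $H\cap K$ is finitely generated, and $0/0$ is understood to be $1$. *)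

theory Defs
  imports
    "HOL-Library.Extended_Real"
    "HOL-Algebra.Coset"
    "HOL-Algebra.Generated_Groups"
    "HOL-Algebra.Elementary_Groups"
    "HOL-Algebra.Product_Groups"
begin

section \<open>Free groups as groups of reduced words\<close>

text \<open>A letter \<open>(x, True)\<close> stands for the generator \<open>x\<close>, and \<open>(x, False)\<close> for its inverse.\<close>

type_synonym 'a word = "('a \<times> bool) list"

definition flip :: "'a \<times> bool \<Rightarrow> 'a \<times> bool" where
  "flip l = (fst l, \<not> snd l)"

definition reduced :: "'a word \<Rightarrow> bool" where
  "reduced = successively (\<lambda>l l'. l' \<noteq> flip l)"

fun push :: "'a \<times> bool \<Rightarrow> 'a word \<Rightarrow> 'a word" where
  "push l [] = [l]"
| "push l (l' # w) = (if l' = flip l then w else l # l' # w)"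

text \<open>For a reduced \<open>v\<close>, \<open>foldr push u v\<close> is the reduced form of the concatenation \<open>u @ v\<close>.\<close>

definition free_group :: "'a set \<Rightarrow> 'a word monoid" where
  "free_group X = \<lparr>carrier = {w. reduced w \<and> fst ` set w \<subseteq> X},
                   monoid.mult = (\<lambda>u v. foldr push u v),
                   one = []\<rparr>"

lemma flip_flip [simp]: "flip (flip l) = l"
  by (simp add: flip_def)

lemma flip_eq_iff [simp]: "flip l = flip l' \<longleftrightarrow> l = l'"
  by (metis flip_flip)

lemma fst_flip [simp]: "fst (flip l) = fst l"
  by (simp add: flip_def)

lemma reduced_Nil [simp]: "reduced []"
  by (simp add: reduced_def)

lemma reduced_Cons: "reduced (l # w) \<longleftrightarrow> reduced w \<and> (w = [] \<or> hd w \<noteq> flip l)"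
  by (cases w) (auto simp: reduced_def)

lemma reduced_push: "reduced w \<Longrightarrow> reduced (push l w)"
  by (cases w) (auto simp: reduced_Cons)

lemma reduced_foldr_push: "reduced v \<Longrightarrow> reduced (foldr push u v)"
  by (induction u) (auto simp: reduced_push)

lemma push_push_flip: "reduced w \<Longrightarrow> push l (push (flip l) w) = w"
  by (cases w; cases "tl w") (auto simp: reduced_Cons)

lemma push_reduced: "reduced (l # w) \<Longrightarrow> push l w = l # w"
  by (cases w) (auto simp: reduced_Cons)

lemma foldr_push_Nil: "reduced u \<Longrightarrow> foldr push u [] = u"
proof (induction u)
  case (Cons l u)
  then show ?case
    using push_reduced[of l u] by (simp add: reduced_Cons)
qed simp

lemma foldr_push_push:
  assumes "reduced w"
  shows "foldr push (push l s) w = push l (foldr push s w)"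
proof (cases s)
  case (Cons l' s')
  then show ?thesis
    using assms by (simp add: push_push_flip reduced_foldr_push)
qed simp

lemma foldr_push_assoc:
  assumes "reduced w"
  shows "foldr push (foldr push u v) w = foldr push u (foldr push v w)"
  by (induction u) (simp_all add: foldr_push_push assms)

lemma set_push: "set (push l w) \<subseteq> insert l (set w)"
  by (cases w) auto

lemma set_foldr_push: "set (foldr push u v) \<subseteq> set u \<union> set v"
proof (induction u)
  case (Cons l u)
  then show ?case
    using set_push[of l "foldr push u v"] by auto
qed simp

lemma foldr_push_left_inverse:
  "foldr push (rev (map flip w)) (foldr push w []) = []"
proof (induction w)
  case (Cons l w)
  have "push (flip l) (push l (foldr push w [])) = foldr push w []"
    using push_push_flip[of "foldr push w []" "flip l"] by (simp add: reduced_foldr_push)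
  with Cons show ?case by simp
qed simp

theorem group_free_group: "group (free_group X)"
proof (rule groupI)
  fix u v
  assume "u \<in> carrier (free_group X)" "v \<in> carrier (free_group X)"
  then show "u \<otimes>\<^bsub>free_group X\<^esub> v \<in> carrier (free_group X)"
    using set_foldr_push[of u v] by (fastforce simp: free_group_def reduced_foldr_push)
next
  fix u
  assume u: "u \<in> carrier (free_group X)"
  define v where "v = foldr push (rev (map flip u)) []"
  have "fst ` set v \<subseteq> fst ` set u"
    using image_mono[OF set_foldr_push, of fst "rev (map flip u)" "[]"]
    by (simp add: v_def image_image)
  with u have "v \<in> carrier (free_group X)"
    by (auto simp: free_group_def v_def reduced_foldr_push)
  moreover have "foldr push v u = []"
    using u foldr_push_left_inverse[of u]
    by (simp add: v_def free_group_def foldr_push_assoc foldr_push_Nil)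
  ultimately show "\<exists>v\<in>carrier (free_group X). v \<otimes>\<^bsub>free_group X\<^esub> u = \<one>\<^bsub>free_group X\<^esub>"
    by (auto simp: free_group_def)
qed (auto simp: free_group_def foldr_push_assoc)

text \<open>The two facts below are the universal property of the free group on \<open>X\<close>.\<close>

theorem generate_free_group:
  "generate (free_group X) ((\<lambda>x. [(x, True)]) ` X) = carrier (free_group X)"
proof -
  interpret group "free_group X" by (rule group_free_group)
  let ?S = "(\<lambda>x. [(x, True)]) ` X"
  have S: "?S \<subseteq> carrier (free_group X)"
    by (auto simp: free_group_def reduced_Cons)
  have letter: "[l] \<in> generate (free_group X) ?S" if "fst l \<in> X" for l
  proof (cases "snd l")
    case True
    then have "[l] \<in> ?S" using that by (cases l) auto
    then show ?thesis by (rule generate.incl)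
  next
    case False
    let ?g = "[(fst l, True)]"
    have g: "?g \<in> ?S" using that by auto
    have "inv\<^bsub>free_group X\<^esub> ?g = [l]"
    proof (rule inv_equality)
      show "[l] \<otimes>\<^bsub>free_group X\<^esub> ?g = \<one>\<^bsub>free_group X\<^esub>"
        using False by (simp add: free_group_def flip_def)
    qed (use that in \<open>auto simp: free_group_def reduced_Cons\<close>)
    then show ?thesis using generate.inv[OF g, of "free_group X"] by simp
  qed
  have "w \<in> generate (free_group X) ?S" if "reduced w" "fst ` set w \<subseteq> X" for w
    using that
  proof (induction w)
    case Nil
    show ?case using generate.one[of "free_group X" ?S] by (simp add: free_group_def)
  next
    case (Cons l w)
    have "[l] \<otimes>\<^bsub>free_group X\<^esub> w \<in> generate (free_group X) ?S"
      using Cons by (intro generate.eng letter) (auto simp: reduced_Cons)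
    moreover have "[l] \<otimes>\<^bsub>free_group X\<^esub> w = l # w"
      using push_reduced[OF Cons.prems(1)] by (simp add: free_group_def)
    ultimately show ?case by simp
  qed
  moreover have "generate (free_group X) ?S \<subseteq> carrier (free_group X)"
    by (rule generate_incl[OF S])
  ultimately show ?thesis by (auto simp: free_group_def)
qed

theorem free_group_extend:
  assumes "group G" and f: "f \<in> X \<rightarrow> carrier G"
  shows "\<exists>h\<in>hom (free_group X) G. \<forall>x\<in>X. h [(x, True)] = f x"
proof -
  interpret group G by fact
  define e where "e l = (if snd l then f (fst l) else inv\<^bsub>G\<^esub> (f (fst l)))" for l
  define h where "h w = foldr (\<lambda>l g. e l \<otimes>\<^bsub>G\<^esub> g) w \<one>\<^bsub>G\<^esub>" for w
  have e: "e l \<in> carrier G" if "fst l \<in> X" for l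
    using f that by (auto simp: e_def)
  have e_flip: "e l \<otimes>\<^bsub>G\<^esub> e (flip l) = \<one>\<^bsub>G\<^esub>" if "fst l \<in> X" for l
    using f that by (auto simp: e_def flip_def Pi_iff)
  have h: "h w \<in> carrier G" if "fst ` set w \<subseteq> X" for w
    using that by (induction w) (auto simp: h_def e)
  have h_Cons: "h (l # w) = e l \<otimes>\<^bsub>G\<^esub> h w" for l w
    by (simp add: h_def)
  have h_push: "h (push l w) = e l \<otimes>\<^bsub>G\<^esub> h w" if "fst l \<in> X" "fst ` set w \<subseteq> X" for l w
  proof (cases w)
    case (Cons l' w')
    show ?thesis
    proof (cases "l' = flip l")
      case True
      have "e l \<otimes>\<^bsub>G\<^esub> (e (flip l) \<otimes>\<^bsub>G\<^esub> h w') = h w'"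
        using that Cons by (simp add: m_assoc[symmetric] e h e_flip)
      then show ?thesis using True Cons by (simp add: h_Cons)
    qed (simp add: Cons h_Cons)
  qed (simp add: h_Cons)
  have h_mult: "h (foldr push u v) = h u \<otimes>\<^bsub>G\<^esub> h v"
    if "fst ` set u \<subseteq> X" "fst ` set v \<subseteq> X" for u v
    using that(1)
  proof (induction u)
    case Nil
    show ?case using h[OF that(2)] by (simp add: h_def)
  next
    case (Cons l u)
    have "fst ` set (foldr push u v) \<subseteq> X"
      using set_foldr_push[of u v] Cons.prems that(2) by fastforce
    with Cons show ?case
      by (simp add: h_push h_Cons e h that(2) m_assoc)
  qed
  have "h \<in> hom (free_group X) G"
    by (auto simp: hom_def free_group_def h h_mult)
  moreover have "h [(x, True)] = f x" if "x \<in> X" for x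
    using f that by (auto simp: h_def e_def Pi_iff)
  ultimately show ?thesis by blast
qed

section \<open>Rank and degree of inertia\<close>

text \<open>A subgroup \<open>H\<close> of \<open>G\<close> is regarded as the group \<open>G\<lparr>carrier := H\<rparr>\<close>.\<close>

definition finitely_generated :: "('a, 'b) monoid_scheme \<Rightarrow> bool" where
  "finitely_generated G \<longleftrightarrow> (\<exists>S. finite S \<and> S \<subseteq> carrier G \<and> generate G S = carrier G)"

text \<open>As a natural number, the rank is only meaningful for finitely generated groups.\<close>

definition group_rank :: "('a, 'b) monoid_scheme \<Rightarrow> nat" where
  "group_rank G =
     (LEAST k. \<exists>S. finite S \<and> S \<subseteq> carrier G \<and> generate G S = carrier G \<and> card S = k)"

definition reduced_rank :: "('a, 'b) monoid_scheme \<Rightarrow> real" where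
  "reduced_rank G = max 0 (real (group_rank G) - 1)"

text \<open>The quotient with the convention \<open>0 / 0 = 1\<close>. In \<open>ereal\<close>, \<open>a / 0 = \<infinity>\<close> for \<open>a > 0\<close>; this
  does not occur in a degree of inertia, since every subgroup of a cyclic group is cyclic.\<close>

definition inertia_quotient :: "real \<Rightarrow> real \<Rightarrow> ereal" where
  "inertia_quotient a b = (if a = 0 \<and> b = 0 then 1 else ereal a / ereal b)"

definition degree_of_inertia :: "('a, 'b) monoid_scheme \<Rightarrow> 'a set \<Rightarrow> ereal" where
  "degree_of_inertia G H =
     (SUP K \<in> {K. subgroup K G \<and> finitely_generated (G\<lparr>carrier := K\<rparr>) \<and>
                  finitely_generated (G\<lparr>carrier := H \<inter> K\<rparr>)}.
        inertia_quotient (reduced_rank (G\<lparr>carrier := H \<inter> K\<rparr>))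
                         (reduced_rank (G\<lparr>carrier := K\<rparr>)))"

section \<open>Free-abelian times free groups\<close>

definition Z_pow :: "nat \<Rightarrow> (nat \<Rightarrow> int) monoid" where
  "Z_pow m = product_group {..<m} (\<lambda>_. integer_group)"

definition Fn :: "nat \<Rightarrow> nat word monoid" where
  "Fn n = free_group {..<n}"

definition ZF :: "nat \<Rightarrow> nat \<Rightarrow> ((nat \<Rightarrow> int) \<times> nat word) monoid" where
  "ZF m n = Z_pow m \<times>\<times> Fn n"

text \<open>The factor \<open>\<int>\<^sup>m\<close>, as a subgroup of \<open>\<int>\<^sup>m \<times> F\<^sub>n\<close>.\<close>

definition Z_factor :: "nat \<Rightarrow> nat \<Rightarrow> ((nat \<Rightarrow> int) \<times> nat word) set" where
  "Z_factor m n = carrier (Z_pow m) \<times> {\<one>\<^bsub>Fn n\<^esub>}"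

text \<open>The index of a subgroup \<open>L\<close> of \<open>G\<close>, with all infinite indices identified.\<close>

definition subgroup_index :: "('a, 'b) monoid_scheme \<Rightarrow> 'a set \<Rightarrow> enat" where
  "subgroup_index G L =
     (if finite (rcosets\<^bsub>G\<^esub> L) then enat (card (rcosets\<^bsub>G\<^esub> L)) else \<infinity>)"

end

theory Submission
  imports Defs
begin

text \<open>
  The projection \<open>\<pi>\<close> from \<open>G = \<int>\<^sup>m \<times> F\<^sub>n\<close> to \<open>F\<^sub>n\<close> has a finitely generated central kernel \<open>C\<close> and a
  free image; the argument works for every such extension. For a finitely generated subgroup \<open>K\<close> put
  \<open>L\<^sub>K = K \<inter> C\<close>. Since \<open>K\<pi>\<close> is free, \<open>K\<close> is the direct product of \<open>L\<^sub>K\<close> and a copy of \<open>K\<pi>\<close>, and ranks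
  add up: \<open>r(K) = r(L\<^sub>K) + r(K\<pi>)\<close>. The inequality \<open>r(K) \<ge> r(L\<^sub>K) + r(K\<pi>)\<close> is the one with content. It is
  obtained from the homomorphism of \<open>K\<close> to the commutative group \<open>L\<^sub>K \<times> \<int>\<^sup>E\<close>, where \<open>E\<close> is a basis of
  \<open>K\<pi>\<close>: by the Euclidean algorithm on generators, passing to the kernel of each of the \<open>card E\<close>
  coordinates to \<open>\<int>\<close> saves one generator (\<open>gens_le_common_kernel\<close>, \<open>rank_splits\<close>).

  Because \<open>L\<^bsub>H \<inter> K\<^esub> \<subseteq> L\<^sub>K\<close> needs no more generators than \<open>L\<^sub>K\<close>, always
  \<open>r(H \<inter> K) \<le> r(L\<^sub>K) + r((H \<inter> K)\<pi>)\<close>. If \<open>H\<pi>\<close> or \<open>K\<pi>\<close> is cyclic, then \<open>r((H \<inter> K)\<pi>) \<le> r(K\<pi>)\<close>, so that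
  \<open>r(H \<inter> K) \<le> r(K)\<close>; this is the first claim. If \<open>[C : L\<^sub>H] = l\<close> is finite, then \<open>(H \<inter> K)\<pi>\<close> has index at
  most \<open>l\<close> in \<open>H\<pi> \<inter> K\<pi>\<close> (\<open>index_image_le\<close>), and Schreier's index formula multiplies the reduced rank
  of \<open>H\<pi> \<inter> K\<pi>\<close>, which the degree of inertia of \<open>H\<pi>\<close> bounds in terms of that of \<open>K\<pi>\<close>, by at most \<open>l\<close>; this
  is the third claim.

  If \<open>[C : L\<^sub>H]\<close> is infinite, some \<open>t \<in> C\<close> has no nontrivial power in \<open>H\<close>. Choose a lift \<open>\<sigma>\<close> of the free group
  \<open>H\<pi>\<close> to \<open>H\<close> and an epimorphism \<open>\<chi>\<close> from \<open>H\<pi>\<close> to \<open>\<int>\<close>. The subgroup \<open>K\<close> of all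
  \<open>\<sigma>(w) t\<^sup>i\<close> with \<open>i \<equiv> \<chi>(w)\<close> modulo \<open>N\<close> has rank at most \<open>r(H\<pi>) + 1\<close>, but \<open>H \<inter> K\<close> consists of the \<open>\<sigma>(w)\<close> with
  \<open>N\<close> dividing \<open>\<chi>(w)\<close>, a copy of a subgroup of index \<open>N\<close> in \<open>H\<pi>\<close>, whose rank grows with \<open>N\<close> since \<open>r(H\<pi>) \<ge> 2\<close>
  (\<open>large_intersection\<close>).

  The facts on free groups that enter, the Nielsen-Schreier theorem with the index formula, come from a
  spanning tree of a Schreier graph (\<open>stabilizer_free\<close>, \<open>preimage_free\<close>).
\<close>

section \<open>Numbers of generators\<close>

text \<open>Upper bounds on ranks are stated relative to one ambient group, so that bounds for a subgroup, for
  its image and for its part in a kernel combine without any change of carrier.\<close>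

definition gens_le :: "('a, 'b) monoid_scheme \<Rightarrow> 'a set \<Rightarrow> nat \<Rightarrow> bool" where
  "gens_le G K k \<longleftrightarrow> (\<exists>S. finite S \<and> S \<subseteq> K \<and> generate G S = K \<and> card S \<le> k)"

lemma gens_leI: "finite S \<Longrightarrow> S \<subseteq> K \<Longrightarrow> generate G S = K \<Longrightarrow> card S \<le> k \<Longrightarrow> gens_le G K k"
  by (auto simp: gens_le_def)

lemma gens_le_mono: "gens_le G K k \<Longrightarrow> k \<le> k' \<Longrightarrow> gens_le G K k'"
  by (force simp: gens_le_def)

lemma (in group) gens_le_imp_rank:
  assumes K: "subgroup K G" and k: "gens_le G K k"
  shows "finitely_generated (G\<lparr>carrier := K\<rparr>)" "group_rank (G\<lparr>carrier := K\<rparr>) \<le> k"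
proof -
  obtain S where S: "finite S" "S \<subseteq> K" "generate G S = K" "card S \<le> k"
    using k by (auto simp: gens_le_def)
  have gen: "generate (G\<lparr>carrier := K\<rparr>) S = K"
    using generate_consistent[OF S(2) K] S(3) by simp
  then show "finitely_generated (G\<lparr>carrier := K\<rparr>)"
    unfolding finitely_generated_def using S by auto
  have "group_rank (G\<lparr>carrier := K\<rparr>) \<le> card S"
    unfolding group_rank_def by (rule Least_le) (use S gen in auto)
  then show "group_rank (G\<lparr>carrier := K\<rparr>) \<le> k" using S(4) by simp
qed

lemma (in group) gens_le_rank:
  assumes K: "subgroup K G" and fg: "finitely_generated (G\<lparr>carrier := K\<rparr>)"
  shows "gens_le G K (group_rank (G\<lparr>carrier := K\<rparr>))"
proof -
  let ?P = "\<lambda>k. \<exists>S. finite S \<and> S \<subseteq> carrier (G\<lparr>carrier := K\<rparr>)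
      \<and> generate (G\<lparr>carrier := K\<rparr>) S = carrier (G\<lparr>carrier := K\<rparr>) \<and> card S = k"
  have "\<exists>k. ?P k" using fg unfolding finitely_generated_def by blast
  then have "?P (group_rank (G\<lparr>carrier := K\<rparr>))"
    unfolding group_rank_def by (rule LeastI_ex)
  then obtain S where S: "finite S" "S \<subseteq> K" "generate (G\<lparr>carrier := K\<rparr>) S = K"
    "card S = group_rank (G\<lparr>carrier := K\<rparr>)" by auto
  then show ?thesis
    using generate_consistent[OF S(2) K] by (intro gens_leI[of S]) simp_all
qed

lemma (in group_hom) gens_le_image:
  assumes "gens_le G K k" and "K \<subseteq> carrier G"
  shows "gens_le H (h ` K) k"
proof -
  obtain S where S: "finite S" "S \<subseteq> K" "generate G S = K" "card S \<le> k"
    using assms by (auto simp: gens_le_def)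
  show ?thesis
  proof (rule gens_leI)
    show "generate H (h ` S) = h ` K" using generate_img[of S] S assms(2) by simp
    show "card (h ` S) \<le> k" using card_image_le[OF S(1), of h] S(4) by linarith
  qed (use S in auto)
qed

text \<open>Preimages of generators of the image correct any element of \<open>M\<close> to one of the kernel.\<close>

lemma (in group_hom) gens_le_extension:
  assumes M: "subgroup M G"
    and a: "gens_le G {x \<in> M. h x = \<one>\<^bsub>H\<^esub>} a" and b: "gens_le H (h ` M) b"
  shows "gens_le G M (a + b)"
proof -
  note Msub = subgroup.subset[OF M]
  obtain S where S: "finite S" "S \<subseteq> {x \<in> M. h x = \<one>\<^bsub>H\<^esub>}"
    "generate G S = {x \<in> M. h x = \<one>\<^bsub>H\<^esub>}" "card S \<le> a"
    using a unfolding gens_le_def by blast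
  obtain T where T: "finite T" "T \<subseteq> h ` M" "generate H T = h ` M" "card T \<le> b"
    using b unfolding gens_le_def by blast
  obtain T' where T': "T' \<subseteq> M" "finite T'" "h ` T' = T" "card T' = card T"
    using T(1,2) by (metis finite_image_iff subset_image_inj card_image)
  have ST: "S \<union> T' \<subseteq> M" using S T' by auto
  have "x \<in> generate G (S \<union> T')" if x: "x \<in> M" for x
  proof -
    have "T' \<subseteq> carrier G" using T'(1) Msub by auto
    then have "h ` generate G T' = h ` M"
      using generate_img[of T'] T(3) T'(3) by simp
    then have "h x \<in> h ` generate G T'" using x by simp
    then obtain y where y: "y \<in> generate G T'" "h x = h y" by auto
    have yM: "y \<in> M" using y(1) T'(1) G.generate_subgroup_incl[OF T'(1) M] by auto
    have car: "x \<in> carrier G" "y \<in> carrier G" using x yM Msub by auto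
    have "x \<otimes>\<^bsub>G\<^esub> inv\<^bsub>G\<^esub> y \<in> generate G S"
      using S(3) car x yM M y(2) by (simp add: subgroup.m_closed subgroup.m_inv_closed)
    then have "x \<otimes>\<^bsub>G\<^esub> inv\<^bsub>G\<^esub> y \<in> generate G (S \<union> T')"
      using G.mono_generate[of S "S \<union> T'"] by auto
    moreover have "y \<in> generate G (S \<union> T')"
      using y(1) G.mono_generate[of T' "S \<union> T'"] by auto
    ultimately have "x \<otimes>\<^bsub>G\<^esub> inv\<^bsub>G\<^esub> y \<otimes>\<^bsub>G\<^esub> y \<in> generate G (S \<union> T')"
      by (rule generate.eng)
    then show ?thesis using car by (simp add: G.m_assoc)
  qed
  then have "generate G (S \<union> T') = M"
    using G.generate_subgroup_incl[OF ST M] by auto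
  moreover have "card (S \<union> T') \<le> a + b"
    using card_Un_le[of S T'] S(4) T(4) T'(4) by linarith
  ultimately show ?thesis using S(1) T'(2) ST by (intro gens_leI[of "S \<union> T'"]) auto
qed

section \<open>Generators in commutative groups\<close>

lemma (in comm_group) generate_insert:
  assumes a: "a \<in> carrier G" and S: "S \<subseteq> carrier G"
  shows "generate G (insert a S) = {a [^] (n::int) \<otimes> t | n t. t \<in> generate G S}" (is "_ = ?R")
proof
  have gS: "subgroup (generate G S) G" by (rule generate_is_subgroup[OF S])
  note tc = subgroup.mem_carrier[OF gS]
  show "generate G (insert a S) \<subseteq> ?R"
  proof
    fix x assume "x \<in> generate G (insert a S)"
    then show "x \<in> ?R"
    proof (induction rule: generate.induct)
      case one
      show ?case using subgroup.one_closed[OF gS] by (force intro!: exI[of _ "0::int"] exI[of _ "\<one>"])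
    next
      case (incl h)
      then consider "h = a" | "h \<in> S" by auto
      then show ?case
      proof cases
        case 1
        then show ?thesis using a subgroup.one_closed[OF gS]
          by (force intro!: exI[of _ "1::int"] exI[of _ "\<one>"])
      next
        case 2
        then show ?thesis using S generate.incl[of h S G] 
          by (force intro!: exI[of _ "0::int"] exI[of _ h])
      qed
    next
      case (inv h)
      then consider "h = a" | "h \<in> S" by auto
      then show ?case
      proof cases
        case 1
        then show ?thesis using a subgroup.one_closed[OF gS]
          by (force simp: int_pow_neg intro!: exI[of _ "-1::int"] exI[of _ "\<one>"])
      next
        case 2
        then show ?thesis using S generate.inv[of h S G] 
          by (force intro!: exI[of _ "0::int"] exI[of _ "inv h"])
      qed
    next
      case (eng x y)
      then obtain n t n' t' where *: "x = a [^] (n::int) \<otimes> t" "t \<in> generate G S"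
        "y = a [^] (n'::int) \<otimes> t'" "t' \<in> generate G S" by blast
      have "x \<otimes> y = a [^] (n + n') \<otimes> (t \<otimes> t')"
        using * a tc by (simp add: int_pow_mult m_ac)
      then show ?case using * subgroup.m_closed[OF gS] by blast
    qed
  qed
  have gaS: "subgroup (generate G (insert a S)) G"
    using a S by (intro generate_is_subgroup) auto
  have "a \<in> generate G (insert a S)" by (rule generate.incl) simp
  then have "a [^] (n::int) \<in> generate G (insert a S)" for n
    by (rule subgroup_int_pow_closed[OF gaS])
  moreover have "generate G S \<subseteq> generate G (insert a S)" by (rule mono_generate) auto
  ultimately show "?R \<subseteq> generate G (insert a S)"
    using subgroup.m_closed[OF gaS] by blast
qed

text \<open>Induction on the generators. When a generator \<open>a\<close> is added to \<open>S\<close>, the exponents of \<open>a\<close> that occur in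
  elements of \<open>C\<close> form an ideal \<open>d\<int>\<close>, and one element of \<open>C\<close> with exponent \<open>d\<close> reduces every other
  element of \<open>C\<close> to one without \<open>a\<close>.\<close>

lemma (in comm_group) gens_le_subgroup:
  assumes "gens_le G A k" and A: "A \<subseteq> carrier G" and C: "subgroup C G" "C \<subseteq> A"
  shows "gens_le G C k"
proof -
  have main: "\<exists>T. finite T \<and> T \<subseteq> C \<and> generate G T = C \<and> card T \<le> card S"
    if "finite S" "S \<subseteq> carrier G" "subgroup C G" "C \<subseteq> generate G S" for S C
    using that
  proof (induction S arbitrary: C rule: finite_induct)
    case empty
    then have "C = {\<one>}" using generate_empty subgroup.one_closed by fastforce
    then show ?case using generate_empty by (intro exI[of _ "{}"]) auto
  next
    case (insert a S)
    have a: "a \<in> carrier G" and S: "S \<subseteq> carrier G" using insert.prems by auto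
    have gS: "subgroup (generate G S) G" by (rule generate_is_subgroup[OF S])
    note tc = subgroup.mem_carrier[OF gS]
    note Cc = subgroup.mem_carrier[OF insert.prems(2)]
    have C0: "subgroup (C \<inter> generate G S) G"
      using insert.prems(2) gS by (rule subgroups_Inter_pair)
    then obtain T where T: "finite T" "T \<subseteq> C \<inter> generate G S"
      "generate G T = C \<inter> generate G S" "card T \<le> card S"
      using insert.IH[of "C \<inter> generate G S"] S by auto
    define I where "I = {n::int. \<exists>t\<in>generate G S. a [^] n \<otimes> t \<in> C}"
    have I0: "0 \<in> I" using subgroup.one_closed[OF gS] subgroup.one_closed[OF insert.prems(2)] 
      by (auto simp: I_def intro!: bexI[of _ \<one>])
    have Idiff: "n - m \<in> I" if nm: "n \<in> I" "m \<in> I" for n m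
    proof -
      obtain t u where t: "t \<in> generate G S" "a [^] n \<otimes> t \<in> C" "u \<in> generate G S" "a [^] m \<otimes> u \<in> C"
        using nm unfolding I_def by blast
      have "a [^] (n - m) \<otimes> (t \<otimes> inv u) = (a [^] n \<otimes> t) \<otimes> inv (a [^] m \<otimes> u)"
        using t tc a by (simp add: int_pow_diff inv_mult m_ac)
      then have "a [^] (n - m) \<otimes> (t \<otimes> inv u) \<in> C"
        using t insert.prems(2) by (simp add: subgroup.m_closed subgroup.m_inv_closed)
      then show ?thesis using t gS by (auto simp: I_def subgroup.m_closed subgroup.m_inv_closed)
    qed
    have "\<exists>d\<in>I. \<forall>n\<in>I. d dvd n"
    proof (cases "I = {0}")
      case False
      have Ineg: "- n \<in> I" if "n \<in> I" for n using Idiff[OF I0 that] by simp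
      have Iadd: "n + m \<in> I" if "n \<in> I" "m \<in> I" for n m using Idiff[OF that(1) Ineg[OF that(2)]] by simp
      obtain n0 where "n0 \<in> I" "n0 \<noteq> 0" using False I0 by auto
      then have ex: "\<exists>k::nat. 0 < k \<and> int k \<in> I"
        using Ineg[of n0] by (intro exI[of _ "nat \<bar>n0\<bar>"]) (auto simp: abs_if)
      define d where "d = (LEAST k::nat. 0 < k \<and> int k \<in> I)"
      have d: "0 < d" "int d \<in> I" using LeastI_ex[OF ex] by (auto simp: d_def)
      have mult: "int k * int d \<in> I" for k :: nat
        by (induction k) (auto simp: I0 algebra_simps intro: Iadd d)
      have multi: "q * int d \<in> I" for q :: int
        using mult[of "nat q"] Ineg[OF mult[of "nat (- q)"]] by (cases "q \<ge> 0") auto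
      have "int d dvd n" if "n \<in> I" for n
      proof -
        have "n mod int d \<in> I" using Idiff[OF that multi[of "n div int d"]]
          by (simp add: minus_div_mult_eq_mod)
        moreover have "0 \<le> n mod int d" "n mod int d < int d" using d by auto
        ultimately have "n mod int d = 0"
          using not_less_Least[of "nat (n mod int d)" "\<lambda>k. 0 < k \<and> int k \<in> I"]
          unfolding d_def[symmetric] by (smt (verit, best) int_nat_eq zero_less_nat_eq zless_nat_conj nat_int nat_less_iff)
        then show ?thesis by auto
      qed
      then show ?thesis using d by blast
    qed (auto intro: I0)
    then obtain d where d: "d \<in> I" "\<And>n. n \<in> I \<Longrightarrow> d dvd n" by blast
    obtain t0 where t0: "t0 \<in> generate G S" "a [^] d \<otimes> t0 \<in> C" using d(1) unfolding I_def by blast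
    define c where "c = a [^] d \<otimes> t0"
    have cC: "c \<in> C" using t0 by (simp add: c_def)
    have TC: "insert c T \<subseteq> C" using T(2) cC by auto
    have "x \<in> generate G (insert c T)" if x: "x \<in> C" for x
    proof -
      obtain n t where nt: "x = a [^] (n::int) \<otimes> t" "t \<in> generate G S"
        using x insert.prems(3) generate_insert[OF a S] by auto
      then have "n \<in> I" using x by (auto simp: I_def)
      then obtain q where q: "n = d * q" using d(2) by (auto simp: dvd_def)
      have cq: "c [^] q = a [^] n \<otimes> t0 [^] q"
        using a t0 tc by (simp add: c_def int_pow_distrib int_pow_pow q mult.commute)
      have tq: "t0 [^] q \<in> generate G S" using subgroup_int_pow_closed[OF gS] t0 by auto
      have "x \<otimes> inv (c [^] q) = t \<otimes> inv (t0 [^] q)"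
      proof -
        have "x \<otimes> inv (c [^] q) = (a [^] n \<otimes> inv (a [^] n)) \<otimes> (t \<otimes> inv (t0 [^] q))"
          using nt tc[OF tq] tc[OF nt(2)] a cq by (simp only: inv_mult int_pow_closed m_ac inv_closed m_closed)
        then show ?thesis using tc[OF tq] tc[OF nt(2)] a by simp
      qed
      moreover have "t \<otimes> inv (t0 [^] q) \<in> generate G S"
        using nt(2) tq gS by (simp add: subgroup.m_closed subgroup.m_inv_closed)
      moreover have "x \<otimes> inv (c [^] q) \<in> C"
        using x cC insert.prems(2) by (simp add: subgroup.m_closed subgroup.m_inv_closed subgroup_int_pow_closed)
      ultimately have "x \<otimes> inv (c [^] q) \<in> generate G T" using T(3) by simp
      moreover have "x = c [^] q \<otimes> (x \<otimes> inv (c [^] q))"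
        using Cc[OF x] Cc[OF cC] by (metis int_pow_closed inv_closed m_comm m_assoc r_inv r_one)
      ultimately show ?thesis
        using generate_insert[of c T] Cc cC TC by blast
    qed
    then have "generate G (insert c T) = C"
      using generate_subgroup_incl[OF TC insert.prems(2)] by auto
    moreover have "card (insert c T) \<le> card (insert a S)"
      using T insert.hyps card_insert_le_m1 by (simp add: card_insert_if)
    ultimately show ?case using T(1) TC by blast
  qed
  obtain S where S: "finite S" "S \<subseteq> A" "generate G S = A" "card S \<le> k"
    using assms(1) by (auto simp: gens_le_def)
  obtain T where "finite T" "T \<subseteq> C" "generate G T = C" "card T \<le> card S"
    using main[OF S(1) _ C(1)] S A C(2) by auto
  then show ?thesis using S(4) by (auto simp: gens_le_def)
qed

text \<open>The Euclidean algorithm on the values of \<open>chi\<close>: multiplying a generator by another one or by its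
  inverse keeps the generated subgroup and, for suitable signs, lowers the sum of the absolute values,
  as long as two generators have nonzero values.\<close>

lemma (in comm_group) generators_euclid:
  assumes chi: "chi \<in> hom G integer_group"
  shows "finite S \<Longrightarrow> S \<subseteq> carrier G \<Longrightarrow> \<exists>T. finite T \<and> T \<subseteq> carrier G \<and> card T \<le> card S
     \<and> generate G T = generate G S \<and> (\<forall>g\<in>T. \<forall>h\<in>T. chi g \<noteq> 0 \<and> chi h \<noteq> 0 \<longrightarrow> g = h)"
proof (induction S rule: measure_induct_rule[of "\<lambda>S. \<Sum>g\<in>S. nat \<bar>chi g\<bar>"])
  case (less S)
  interpret chi: group_hom G integer_group chi
    using chi by (simp add: group_hom_def group_hom_axioms_def is_group)
  show ?case
  proof (cases "\<forall>g\<in>S. \<forall>h\<in>S. chi g \<noteq> 0 \<and> chi h \<noteq> 0 \<longrightarrow> g = h")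
    case True
    then show ?thesis using less.prems by blast
  next
    case False
    then obtain g h where "g \<in> S" "h \<in> S" "g \<noteq> h" "chi g \<noteq> 0" "chi h \<noteq> 0" by blast
    then obtain g h where gh: "g \<in> S" "h \<in> S" "g \<noteq> h" "chi g \<noteq> 0" "chi h \<noteq> 0" "\<bar>chi h\<bar> \<le> \<bar>chi g\<bar>"
      by (metis linear)
    have car: "g \<in> carrier G" "h \<in> carrier G" using gh less.prems by auto
    define c where "c = (if sgn (chi g) = sgn (chi h) then inv h else h)"
    have c: "c \<in> carrier G" using car by (simp add: c_def)
    have chi_gc: "\<bar>chi (g \<otimes> c)\<bar> = \<bar>chi g\<bar> - \<bar>chi h\<bar>"
      using car gh(4-6) by (auto simp: c_def sgn_if abs_if split: if_splits)
    let ?T = "insert (g \<otimes> c) (S - {g})"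
    have fin: "finite ?T" and Tc: "?T \<subseteq> carrier G" using less.prems car c by auto
    have "(\<Sum>x\<in>?T. nat \<bar>chi x\<bar>) \<le> nat \<bar>chi (g \<otimes> c)\<bar> + (\<Sum>x\<in>S-{g}. nat \<bar>chi x\<bar>)"
      using less.prems(1) by (cases "g \<otimes> c \<in> S - {g}") (auto simp: insert_absorb simp del: insert_Diff_single)
    also have "\<dots> < nat \<bar>chi g\<bar> + (\<Sum>x\<in>S-{g}. nat \<bar>chi x\<bar>)"
      using chi_gc gh by simp
    also have "\<dots> = (\<Sum>x\<in>S. nat \<bar>chi x\<bar>)"
      using less.prems(1) gh(1) by (simp add: sum.remove)
    finally have lt: "(\<Sum>x\<in>?T. nat \<bar>chi x\<bar>) < (\<Sum>x\<in>S. nat \<bar>chi x\<bar>)" .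
    have cin: "c \<in> generate G U" if "h \<in> U" "U \<subseteq> carrier G" for U
      using that generate.incl[of h U G] generate.inv[of h U G] by (simp add: c_def)
    have "generate G ?T = generate G S"
    proof
      have "?T \<subseteq> generate G S"
        using generate.incl[of _ S G] gh cin[of S] less.prems(2) by (auto intro: generate.eng)
      then show "generate G ?T \<subseteq> generate G S"
        by (intro generate_subgroup_incl generate_is_subgroup less.prems)
      have hT: "c \<in> generate G ?T" using cin[of ?T] gh Tc by simp
      then have "g \<otimes> c \<otimes> inv c \<in> generate G ?T"
        using generate_is_subgroup[OF Tc] generate.incl[of "g \<otimes> c" ?T G]
        by (simp add: subgroup.m_closed subgroup.m_inv_closed)
      then have "g \<in> generate G ?T" using car c by (simp add: m_assoc)
      then have "S \<subseteq> generate G ?T" using generate.incl[of _ ?T G] by blast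
      then show "generate G S \<subseteq> generate G ?T"
        by (intro generate_subgroup_incl generate_is_subgroup Tc)
    qed
    moreover have "card ?T \<le> card S"
      using less.prems(1) gh(1) by (metis card_Suc_Diff1 card_insert_le_m1 diff_Suc_1 finite_Diff le_refl zero_less_Suc)
    ultimately show ?thesis using less.IH[OF lt fin Tc] by (metis le_trans)
  qed
qed

text \<open>After the Euclidean algorithm exactly one generator has a nonzero value. A product of generators
  lies in the kernel only if the exponent of this generator is zero, so it can be dropped.\<close>

lemma (in comm_group) gens_le_integer_kernel:
  assumes chi: "chi \<in> hom G integer_group" and "gens_le G A k" and A: "A \<subseteq> carrier G"
    and a: "a \<in> A" "chi a \<noteq> 0"
  shows "\<exists>k'<k. gens_le G {x \<in> A. chi x = 0} k'"
proof -
  interpret chi: group_hom G integer_group chi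
    using chi by (simp add: group_hom_def group_hom_axioms_def is_group)
  obtain S where S: "finite S" "S \<subseteq> A" "generate G S = A" "card S \<le> k"
    using assms(2) by (auto simp: gens_le_def)
  obtain T where T: "finite T" "T \<subseteq> carrier G" "card T \<le> card S" "generate G T = A"
     "\<And>g h. g \<in> T \<Longrightarrow> h \<in> T \<Longrightarrow> chi g \<noteq> 0 \<Longrightarrow> chi h \<noteq> 0 \<Longrightarrow> g = h"
    using generators_euclid[OF chi S(1) subset_trans[OF S(2) A]] unfolding S(3) by metis
  have ker: "chi x = 0" if "x \<in> generate G U" "U \<subseteq> {x \<in> carrier G. chi x = 0}" for x U
  proof -
    have "subgroup {x \<in> carrier G. chi x = 0} G"
      using chi.subgroup_kernel by (simp add: kernel_def)
    then show ?thesis using generate_subgroup_incl[OF that(2)] that(1) by blast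
  qed
  obtain g where g: "g \<in> T" "chi g \<noteq> 0"
    using ker[of a T] T(2,4) a by blast
  let ?U = "T - {g}"
  have Uk: "?U \<subseteq> {x \<in> carrier G. chi x = 0}" using T(2,5) g by blast
  then have Uc: "?U \<subseteq> carrier G" by auto
  have gc: "g \<in> carrier G" using g T(2) by auto
  have ins: "generate G T = {g [^] (n::int) \<otimes> t | n t. t \<in> generate G ?U}"
    using generate_insert[OF gc Uc] g(1) by (simp add: insert_absorb)
  have "x \<in> generate G ?U" if x: "x \<in> A" "chi x = 0" for x
  proof -
    obtain n t where nt: "x = g [^] (n::int) \<otimes> t" "t \<in> generate G ?U"
      using x ins T(4) by blast
    have tc: "t \<in> carrier G" using nt(2) generate_in_carrier[OF Uc] by blast
    have "chi x = n * chi g" using nt gc tc ker[OF nt(2) Uk]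
      by (simp add: chi.hom_int_pow)
    then have "n = 0" using x g by simp
    then show ?thesis using nt tc by simp
  qed
  moreover have "generate G ?U \<subseteq> A" using mono_generate[of ?U T] T(4) by auto
  ultimately have gen: "generate G ?U = {x \<in> A. chi x = 0}" using ker[OF _ Uk] by blast
  then have "gens_le G {x \<in> A. chi x = 0} (card ?U)"
    using T(1) generate.incl[of _ ?U G] by (intro gens_leI[of ?U]) auto
  moreover have "card ?U < k" using T(1,3) S(4) g(1) by (metis card_Diff1_less le_trans order_less_le_trans)
  ultimately show ?thesis by blast
qed

text \<open>The dual elements keep each character nontrivial on the common kernel of the others, so that every
  character saves a generator in turn.\<close>

lemma (in comm_group) gens_le_common_kernel:
  assumes "finite I" and chi: "\<And>i. i \<in> I \<Longrightarrow> chi i \<in> hom G integer_group"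
    and A: "gens_le G A k" "A \<subseteq> carrier G"
    and a: "\<And>i. i \<in> I \<Longrightarrow> a i \<in> A"
    and dual: "\<And>i j. i \<in> I \<Longrightarrow> j \<in> I \<Longrightarrow> chi i (a j) = (if i = j then 1 else 0)"
  shows "\<exists>k'. k' + card I \<le> k \<and> gens_le G {x \<in> A. \<forall>i\<in>I. chi i x = 0} k'"
  using assms(1,2) a dual
proof (induction I rule: finite_induct)
  case empty
  then show ?case using A by auto
next
  case (insert i I)
  let ?A = "{x \<in> A. \<forall>i\<in>I. chi i x = 0}"
  obtain k1 where k1: "k1 + card I \<le> k" "gens_le G ?A k1"
    using insert.IH insert.prems by auto
  have "a i \<in> ?A" using insert by force
  then obtain k2 where "k2 < k1" "gens_le G {x \<in> ?A. chi i x = 0} k2"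
    using gens_le_integer_kernel[OF insert.prems(1)[of i] k1(2), of "a i"] A insert.prems(3)[of i i] by auto
  moreover have "{x \<in> ?A. chi i x = 0} = {x \<in> A. \<forall>j\<in>insert i I. chi j x = 0}" by auto
  ultimately show ?case using insert.hyps k1 by (intro exI[of _ k2]) auto
qed

section \<open>Free groups and their ranks\<close>

lemma carrier_free_group: "carrier (free_group X) = {w. reduced w \<and> fst ` set w \<subseteq> X}"
  and mult_free_group: "u \<otimes>\<^bsub>free_group X\<^esub> v = foldr push u v"
  and one_free_group: "\<one>\<^bsub>free_group X\<^esub> = []"
  by (simp_all add: free_group_def)

lemma letter_in_free_group: "fst l \<in> X \<Longrightarrow> [l] \<in> carrier (free_group X)"
  by (simp add: carrier_free_group reduced_Cons)

lemma Cons_eq_mult_free_group: "reduced (l # w) \<Longrightarrow> l # w = [l] \<otimes>\<^bsub>free_group X\<^esub> w"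
  by (simp add: mult_free_group push_reduced)

lemma inv_letter_free_group:
  assumes "fst l \<in> X"
  shows "inv\<^bsub>free_group X\<^esub> [l] = [flip l]"
proof (rule group.inv_equality[OF group_free_group])
  show "[flip l] \<otimes>\<^bsub>free_group X\<^esub> [l] = \<one>\<^bsub>free_group X\<^esub>"
    by (simp add: mult_free_group one_free_group)
qed (use assms in \<open>auto intro: letter_in_free_group\<close>)

lemma free_group_hom_eq:
  assumes "group G" and f: "f \<in> hom (free_group X) G" and g: "g \<in> hom (free_group X) G"
    and eq: "\<And>x. x \<in> X \<Longrightarrow> f [(x, True)] = g [(x, True)]"
    and w: "w \<in> carrier (free_group X)"
  shows "f w = g w"
proof -
  let ?F = "free_group X" and ?S = "(\<lambda>x. [(x, True)]) ` X"
  interpret F: group ?F by (rule group_free_group)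
  interpret f: group_hom ?F G f
    using assms by (simp add: group_hom_def group_hom_axioms_def F.is_group)
  interpret g: group_hom ?F G g
    using assms by (simp add: group_hom_def group_hom_axioms_def F.is_group)
  have S: "?S \<subseteq> carrier ?F" by (auto intro: letter_in_free_group)
  have "w \<in> generate ?F ?S" using w by (simp add: generate_free_group)
  then show ?thesis
  proof (induction rule: generate.induct)
    case (eng h1 h2)
    then show ?case using F.generate_in_carrier[OF S] by simp
  qed (use S eq in auto)
qed

text \<open>A free group on a finite set \<open>B\<close> has \<open>2 ^ card B\<close> homomorphisms to a group with two elements, and each
  of them is determined by its values on any generating set. Stated as an injection from the subsets
  of \<open>B\<close> to those of \<open>S\<close>, the argument also shows that \<open>B\<close> is finite.\<close>

lemma card_le_generators_free_group:
  assumes S: "finite S" "S \<subseteq> carrier (free_group B)" "generate (free_group B) S = carrier (free_group B)"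
  shows "finite B" "card B \<le> card S"
proof -
  let ?F = "free_group B" and ?Z = "integer_mod_group 2"
  interpret F: group ?F by (rule group_free_group)
  have "\<exists>h\<in>hom ?F ?Z. \<forall>b\<in>B. h [(b, True)] = (if b \<in> A then 1 else 0)" for A
    by (rule free_group_extend) auto
  then obtain h where h: "\<And>A. h A \<in> hom ?F ?Z"
    and hb: "\<And>A b. b \<in> B \<Longrightarrow> h A [(b, True)] = (if b \<in> A then 1 else 0)" by metis
  let ?f = "\<lambda>A. {s \<in> S. h A s \<noteq> 0}"
  have mono: "A \<subseteq> A'" if AB: "A \<subseteq> B" and eq: "?f A = ?f A'" for A A'
  proof
    fix b assume b: "b \<in> A"
    interpret h: group_hom ?F ?Z "h A" using h by (simp add: group_hom_def group_hom_axioms_def)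
    interpret h': group_hom ?F ?Z "h A'" using h by (simp add: group_hom_def group_hom_axioms_def)
    have on_S: "h A s = h A' s" if "s \<in> S" for s
    proof -
      have "h A s \<in> carrier ?Z" "h A' s \<in> carrier ?Z"
        using that S(2) by (auto intro!: hom_in_carrier[OF h])
      moreover have "h A s \<noteq> 0 \<longleftrightarrow> h A' s \<noteq> 0" using eq that by blast
      ultimately show ?thesis by (auto simp: carrier_integer_mod_group)
    qed
    have "h A w = h A' w" if "w \<in> generate ?F S" for w
      using that
    proof (induction rule: generate.induct)
      case (eng h1 h2)
      then show ?case using F.generate_in_carrier[OF S(2)] by (simp del: mult_integer_mod_group)
    qed (use S(2) on_S in \<open>auto simp del: inv_integer_mod_group mult_integer_mod_group\<close>)
    moreover have "[(b, True)] \<in> generate ?F S"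
      using b AB S(3) letter_in_free_group[of "(b, True)" B] by auto
    ultimately show "b \<in> A'" using hb[of b] b AB by (metis subsetD zero_neq_one)
  qed
  have inj: "inj_on ?f (Pow B)"
  proof (rule inj_onI)
    fix A A' assume "A \<in> Pow B" "A' \<in> Pow B" "?f A = ?f A'"
    then show "A = A'" using mono[of A A'] mono[of A' A] by blast
  qed
  have sub: "?f ` Pow B \<subseteq> Pow S" by auto
  have "finite (Pow B)" using inj_on_finite[OF inj sub] S(1) by simp
  then show "finite B" by simp
  have "card (Pow B) \<le> card (Pow S)" using card_inj_on_le[OF inj sub] S(1) by simp
  then show "card B \<le> card S" using S(1) \<open>finite B\<close> by (simp add: card_Pow)
qed

lemma free_basis_le_gens:
  assumes "group G" and P: "subgroup P G" and h: "h \<in> iso (free_group E) (G\<lparr>carrier := P\<rparr>)"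
    and k: "gens_le G P k"
  shows "finite E" "card E \<le> k"
proof -
  interpret G: group G by fact
  obtain S where S: "finite S" "S \<subseteq> P" "generate G S = P" "card S \<le> k"
    using k by (auto simp: gens_le_def)
  let ?GP = "G\<lparr>carrier := P\<rparr>" and ?F = "free_group E"
  have GP: "group ?GP" by (rule G.subgroup_imp_group[OF P])
  let ?g = "inv_into (carrier ?F) h"
  have g: "?g \<in> iso ?GP ?F" by (rule group.iso_set_sym[OF group_free_group h])
  then interpret g: group_hom ?GP ?F ?g
    using GP group_free_group by (auto simp: group_hom_def group_hom_axioms_def iso_def)
  have gen: "generate ?F (?g ` S) = carrier ?F"
    using g.generate_img[of S] S G.generate_consistent[OF S(2) P] g by (simp add: iso_iff)
  have "?g ` S \<subseteq> carrier ?F" using S(2) by (auto intro: g.hom_closed)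
  from card_le_generators_free_group[OF finite_imageI[OF S(1)] this gen]
  show "finite E" "card E \<le> k" using card_image_le[OF S(1), of ?g] S(4) by auto
qed

lemma free_basis_gens_le:
  assumes "group G" and P: "subgroup P G" and h: "h \<in> iso (free_group E) (G\<lparr>carrier := P\<rparr>)"
    and E: "finite E"
  shows "gens_le G P (card E)"
proof -
  interpret G: group G by fact
  let ?GP = "G\<lparr>carrier := P\<rparr>" and ?F = "free_group E" and ?S = "(\<lambda>x. [(x, True)]) ` E"
  have GP: "group ?GP" by (rule G.subgroup_imp_group[OF P])
  interpret h: group_hom ?F ?GP h
    using GP group_free_group h by (auto simp: group_hom_def group_hom_axioms_def iso_def)
  have S: "?S \<subseteq> carrier ?F" by (auto intro: letter_in_free_group)
  have hS: "h ` ?S \<subseteq> P"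
  proof
    fix y assume "y \<in> h ` ?S"
    then obtain s where "y = h s" "s \<in> carrier ?F" using S by blast
    then show "y \<in> P" using h.hom_closed[of s] by simp
  qed
  have "generate ?GP (h ` ?S) = P"
    using h.generate_img[OF S] h by (simp add: generate_free_group iso_iff)
  then have "generate G (h ` ?S) = P" using G.generate_consistent[OF hS P] by simp
  moreover have "card (h ` ?S) \<le> card E"
    using card_image_le[OF finite_imageI[OF E], of h "\<lambda>x. [(x, True)]"]
      card_image_le[OF E, of "\<lambda>x. [(x, True)]"] by linarith
  ultimately show ?thesis using gens_leI[OF finite_imageI[OF finite_imageI[OF E]] hS] by blast
qed

section \<open>Subgroups of free groups\<close>

text \<open>An action of the free group on \<open>X\<close> is read as a graph with vertex set \<open>V\<close>, which has an edge from \<open>v\<close> to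
  \<open>act (x, True) v\<close> for every \<open>x \<in> X\<close>. The word \<open>w\<close> labels a path from \<open>v\<close> to \<open>foldr act w v\<close>, read from
  its last letter to its first. Transitivity of the action is connectedness of the graph, and the
  stabilizer of \<open>v0\<close> is its fundamental group.\<close>

locale free_group_action =
  fixes X :: "'a set" and V :: "'v set" and act :: "'a \<times> bool \<Rightarrow> 'v \<Rightarrow> 'v" and v0 :: 'v
  assumes act_closed: "fst l \<in> X \<Longrightarrow> v \<in> V \<Longrightarrow> act l v \<in> V"
    and act_flip: "fst l \<in> X \<Longrightarrow> v \<in> V \<Longrightarrow> act (flip l) (act l v) = v"
    and base: "v0 \<in> V"
    and reach: "v \<in> V \<Longrightarrow> \<exists>w. fst ` set w \<subseteq> X \<and> foldr act w v0 = v"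
begin

abbreviation F where "F \<equiv> free_group X"

definition stabilizer :: "'a word set" where
  "stabilizer = {w \<in> carrier F. foldr act w v0 = v0}"

lemma act_flip': "fst l \<in> X \<Longrightarrow> v \<in> V \<Longrightarrow> act l (act (flip l) v) = v"
  using act_flip[of "flip l" v] by simp

lemma run_closed: "fst ` set w \<subseteq> X \<Longrightarrow> v \<in> V \<Longrightarrow> foldr act w v \<in> V"
  by (induction w) (auto intro: act_closed)

lemma run_push:
  assumes "fst l \<in> X" "fst ` set w \<subseteq> X" "v \<in> V"
  shows "foldr act (push l w) v = act l (foldr act w v)"
  using assms by (cases w) (auto simp: act_flip' run_closed)

lemma letters_foldr_push:
  "fst ` set u \<subseteq> X \<Longrightarrow> fst ` set w \<subseteq> X \<Longrightarrow> fst ` set (foldr push u w) \<subseteq> X"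
  using set_foldr_push[of u w] by fastforce

lemma run_foldr_push:
  assumes "fst ` set u \<subseteq> X" "fst ` set w \<subseteq> X" "v \<in> V"
  shows "foldr act (foldr push u w) v = foldr act u (foldr act w v)"
  using assms(1)
proof (induction u)
  case (Cons l u)
  then show ?case using run_push[of l "foldr push u w" v] letters_foldr_push[of u w] assms by simp
qed simp

subsection \<open>A spanning tree\<close>

definition depth :: "'v \<Rightarrow> nat" where
  "depth v = (LEAST n. \<exists>w. fst ` set w \<subseteq> X \<and> length w = n \<and> foldr act w v0 = v)"

lemma depth_le: "fst ` set w \<subseteq> X \<Longrightarrow> foldr act w v0 = v \<Longrightarrow> depth v \<le> length w"
  unfolding depth_def by (rule Least_le) auto

lemma depth_witness:
  assumes "v \<in> V"
  shows "\<exists>w. fst ` set w \<subseteq> X \<and> length w = depth v \<and> foldr act w v0 = v"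
  unfolding depth_def by (rule LeastI_ex) (use reach[OF assms] in auto)

lemma depth_base: "depth v0 = 0"
  using depth_le[of "[]" v0] by simp

lemma depth_step:
  assumes v: "v \<in> V" "depth v = Suc n"
  shows "\<exists>l. fst l \<in> X \<and> depth (act (flip l) v) = n"
proof -
  obtain l w where w: "fst ` set (l # w) \<subseteq> X" "length w = n" "act l (foldr act w v0) = v"
    using depth_witness[OF v(1)] v(2) by (auto simp: length_Suc_conv)
  let ?u = "foldr act w v0"
  have uV: "?u \<in> V" using w run_closed[OF _ base] by simp
  have u: "?u = act (flip l) v" using w act_flip[OF _ uV, of l] by simp
  have "depth ?u \<le> n" using depth_le[of w] w by simp
  moreover obtain w' where w': "fst ` set w' \<subseteq> X" "length w' = depth ?u" "foldr act w' v0 = ?u"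
    using depth_witness[OF uV] by blast
  then have "depth v \<le> Suc (depth ?u)" using depth_le[of "l # w'" v] w by simp
  ultimately have "depth (act (flip l) v) = n" using v w u by simp
  then show ?thesis using w by (intro exI[of _ l]) simp
qed

text \<open>A spanning tree of shortest paths: a vertex of depth \<open>n + 1\<close> is joined to one chosen neighbour of depth
  \<open>n\<close>. The word \<open>path n v\<close> is meaningful only if \<open>n\<close> is the depth of \<open>v\<close>; then it labels the path in the
  tree from \<open>v0\<close> to \<open>v\<close>, and its tail labels the path to the neighbour.\<close>

primrec path :: "nat \<Rightarrow> 'v \<Rightarrow> 'a word" where
  "path 0 v = []"
| "path (Suc n) v = (let l = (SOME l. fst l \<in> X \<and> depth (act (flip l) v) = n)
                     in l # path n (act (flip l) v))"

definition rep :: "'v \<Rightarrow> 'a word" where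
  "rep v = path (depth v) v"

lemma rep_base [simp]: "rep v0 = []"
  by (simp add: rep_def depth_base)

lemma rep_step:
  assumes v: "v \<in> V" "v \<noteq> v0"
  obtains l where "fst l \<in> X" "rep v = l # rep (act (flip l) v)" "depth v = Suc (depth (act (flip l) v))"
    "act (flip l) v \<in> V"
proof -
  have "depth v \<noteq> 0"
  proof
    assume "depth v = 0"
    then have "v = foldr act [] v0" using depth_witness[OF v(1)] by auto
    then show False using v(2) by simp
  qed
  then obtain n where n: "depth v = Suc n" by (cases "depth v") auto
  define l where "l = (SOME l. fst l \<in> X \<and> depth (act (flip l) v) = n)"
  have l: "fst l \<in> X" "depth (act (flip l) v) = n"
    using someI_ex[OF depth_step[OF v(1) n]] by (auto simp: l_def)
  have "rep v = l # rep (act (flip l) v)" using n l by (simp add: rep_def l_def Let_def)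
  then show ?thesis using that[of l] l n act_closed[of "flip l" v] v(1) by simp
qed

lemma depth_induct [consumes 1, case_names base step]:
  assumes "v \<in> V" and "P v0"
    and step: "\<And>v l. v \<in> V \<Longrightarrow> fst l \<in> X \<Longrightarrow> act (flip l) v \<in> V \<Longrightarrow> rep v = l # rep (act (flip l) v)
       \<Longrightarrow> P (act (flip l) v) \<Longrightarrow> P v"
  shows "P v"
  using assms(1)
proof (induction "depth v" arbitrary: v rule: less_induct)
  case less
  show ?case
  proof (cases "v = v0")
    case False
    then show ?thesis using rep_step[OF less.prems False] step less by (metis lessI)
  qed (use assms in simp)
qed

lemma rep_letters: "v \<in> V \<Longrightarrow> fst ` set (rep v) \<subseteq> X"
  by (induction rule: depth_induct) auto

lemma run_rep: "v \<in> V \<Longrightarrow> foldr act (rep v) v0 = v"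
  by (induction rule: depth_induct) (auto simp: act_flip')

lemma rep_tail:
  assumes "v \<in> V" "rep v = l # t"
  shows "fst l \<in> X" "t = rep (act (flip l) v)"
proof -
  have "v \<noteq> v0" using assms by auto
  from rep_step[OF assms(1) this] show "fst l \<in> X" "t = rep (act (flip l) v)"
    using assms(2) by (metis list.inject)+
qed

text \<open>A cancelling pair would mean that the path to \<open>v\<close> runs through \<open>v\<close> before its end.\<close>

lemma reduced_rep: "v \<in> V \<Longrightarrow> reduced (rep v)"
proof (induction rule: depth_induct)
  case (step v l)
  let ?u = "act (flip l) v"
  have False if "rep ?u = flip l # t" for t
  proof -
    have "t = rep v" using rep_tail[OF step(3) that] step act_flip'[of l v] by simp
    then show False using that step by simp
  qed
  then show ?case using step by (cases "rep ?u") (auto simp: reduced_Cons)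
qed simp

lemma rep_in_F: "v \<in> V \<Longrightarrow> rep v \<in> carrier F"
  by (simp add: carrier_free_group rep_letters reduced_rep)

definition tree_edge :: "'a \<Rightarrow> 'v \<Rightarrow> bool" where
  "tree_edge x v \<longleftrightarrow> rep (act (x, True) v) = (x, True) # rep v
     \<or> rep v = (x, False) # rep (act (x, True) v)"

text \<open>The edges outside of the tree.\<close>

definition edges :: "('a \<times> 'v) set" where
  "edges = {(x, v). x \<in> X \<and> v \<in> V \<and> \<not> tree_edge x v}"

text \<open>The tree has one edge for each vertex other than \<open>v0\<close>, the last one on the path to this vertex.\<close>

lemma card_edges:
  assumes "finite X" "finite V"
  shows "finite edges" "card edges + card V = card X * card V + 1"
proof -
  have sub: "edges \<subseteq> X \<times> V" by (auto simp: edges_def)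
  then show fin: "finite edges" using assms by (meson finite_SigmaI finite_subset)
  define T where "T = X \<times> V - edges"
  have T: "(x, v) \<in> T \<longleftrightarrow> x \<in> X \<and> v \<in> V \<and> tree_edge x v" for x v
    by (auto simp: T_def edges_def)
  define g where "g = (\<lambda>(x, v). if rep (act (x, True) v) = (x, True) # rep v then act (x, True) v else v)"
  have "bij_betw g T (V - {v0})"
    unfolding bij_betw_def
  proof
    have gV: "rep (g (x, v)) = (if rep (act (x, True) v) = (x, True) # rep v
        then (x, True) # rep v else (x, False) # rep (act (x, True) v))" if "(x, v) \<in> T" for x v
      using that T[of x v] by (auto simp: g_def tree_edge_def)
    have no_back: "rep v \<noteq> l # l' # rep v" for v l l' 
      by (metis impossible_Cons length_Cons le_SucI order_refl)
    show "inj_on g T"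
    proof (rule inj_onI)
      fix e e' assume e: "e \<in> T" "e' \<in> T" "g e = g e'"
      obtain x v y u where xy: "e = (x, v)" "e' = (y, u)" by (cases e; cases e')
      have 1: "x \<in> X" "v \<in> V" "y \<in> X" "u \<in> V" "tree_edge x v" "tree_edge y u"
        using e xy T by auto
      show "e = e'"
      proof (cases "rep (act (x, True) v) = (x, True) # rep v")
        case a: True
        show ?thesis
        proof (cases "rep (act (y, True) u) = (y, True) # rep u")
          case True
          then have "act (x, True) v = act (y, True) u" "x = y"
            using a e gV[of x v] gV[of y u] xy by (auto simp: g_def)
          then have "v = u" using act_flip[of "(x, True)" v] act_flip[of "(x, True)" u] 1 by simp
          then show ?thesis using xy \<open>x = y\<close> by simp
        next
          case False
          then show ?thesis
            using a e gV[of x v] gV[of y u] xy by auto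
        qed
      next
        case b: False
        show ?thesis
        proof (cases "rep (act (y, True) u) = (y, True) # rep u")
          case True
          then show ?thesis
            using b e gV[of x v] gV[of y u] xy by auto
        next
          case False
          then show ?thesis
            using b e gV[of x v] gV[of y u] xy by (auto simp: g_def)
        qed
      qed
    qed
    show "g ` T = V - {v0}"
    proof
      show "g ` T \<subseteq> V - {v0}"
      proof
        fix v assume "v \<in> g ` T"
        then obtain x u where xu: "v = g (x, u)" "(x, u) \<in> T" by auto
        have "rep v \<noteq> []" using gV[OF xu(2)] xu(1) by simp
        moreover have "v \<in> V" using xu T[of x u] act_closed[of "(x, True)" u] by (auto simp: g_def)
        ultimately show "v \<in> V - {v0}" by auto
      qed
      show "V - {v0} \<subseteq> g ` T"
      proof
        fix v assume "v \<in> V - {v0}"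
        then have v: "v \<in> V" "v \<noteq> v0" by auto
        obtain l where l: "fst l \<in> X" "rep v = l # rep (act (flip l) v)" "act (flip l) v \<in> V"
          using rep_step[OF v] by metis
        show "v \<in> g ` T"
        proof (cases "snd l")
          case True
          then have lx: "l = (fst l, True)" by (metis prod.collapse)
          let ?u = "act (flip l) v"
          have au: "act (fst l, True) ?u = v" using act_flip'[OF l(1) v(1)] lx by simp
          then have "(fst l, ?u) \<in> T" using T[of "fst l" ?u] l lx by (simp add: tree_edge_def)
          moreover have "g (fst l, ?u) = v" using au l(2) lx by (simp add: g_def)
          ultimately show ?thesis by force
        next
          case False
          then have lx: "l = (fst l, False)" by (metis prod.collapse)
          have fl: "flip l = (fst l, True)" using False by (simp add: flip_def)
          have "(fst l, v) \<in> T" using T[of "fst l" v] l lx v fl by (simp add: tree_edge_def)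
          moreover have "g (fst l, v) = v"
            using l(2) fl no_back[of v "(fst l, True)" l] no_back[of v l "(fst l, True)"] 
            by (auto simp: g_def)
          ultimately show ?thesis by force
        qed
      qed
    qed
  qed
  then have "card T = card V - 1" using bij_betw_same_card base assms(2) by fastforce
  moreover have "card T = card X * card V - card edges"
    using card_Diff_subset[OF fin sub] by (simp add: T_def card_cartesian_product)
  moreover have "card edges \<le> card X * card V"
    using card_mono[OF _ sub] assms by (simp add: card_cartesian_product)
  moreover have "card V > 0" using base assms(2) card_gt_0_iff by blast
  ultimately show "card edges + card V = card X * card V + 1" by linarith
qed

subsection \<open>The basis given by the remaining edges\<close>

abbreviation FE where "FE \<equiv> free_group edges"

text \<open>A letter, read as a step from \<open>v\<close>, contributes the edge that it crosses, unless this is a tree edge.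
  An inverse letter crosses an edge that starts at the end of the step.\<close>

definition edge_label :: "'a \<times> bool \<Rightarrow> 'v \<Rightarrow> ('a \<times> 'v) word" where
  "edge_label l v = (let e = (fst l, if snd l then v else act l v) in if e \<in> edges then [(e, snd l)] else [])"

text \<open>The freely reduced word of the edges outside of the tree that are crossed by the path from \<open>v\<close> labelled \<open>w\<close>.\<close>

primrec crossings :: "'a word \<Rightarrow> 'v \<Rightarrow> ('a \<times> 'v) word" where
  "crossings [] v = []"
| "crossings (l # w) v = foldr push (edge_label l (foldr act w v)) (crossings w v)"

lemma edge_label_in_FE: "edge_label l v \<in> carrier FE"
  by (auto simp: edge_label_def Let_def carrier_free_group reduced_Cons)

lemma crossings_in_FE: "crossings w v \<in> carrier FE"
proof (induction w)
  case Nil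
  show ?case by (simp add: carrier_free_group)
next
  case (Cons l w)
  have "edge_label l (foldr act w v) \<otimes>\<^bsub>FE\<^esub> crossings w v \<in> carrier FE"
    using edge_label_in_FE Cons by (simp add: monoid.m_closed[OF group.is_monoid[OF group_free_group]])
  then show ?case by (simp add: mult_free_group)
qed

lemma reduced_crossings: "reduced (crossings w v)"
  using crossings_in_FE[of w v] by (simp add: carrier_free_group)

lemma edge_label_flip:
  assumes "fst l \<in> X" "v \<in> V" "reduced w"
  shows "foldr push (edge_label l (act (flip l) v)) (foldr push (edge_label (flip l) v) w) = w"
proof -
  have *: "push (e, b) (push (e, \<not> b) w) = w" for e b
    using push_push_flip[OF assms(3), of "(e, b)"] by (simp add: flip_def)
  show ?thesis
    using assms act_flip'[of l v] *[of _ True] *[of _ False]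
    by (auto simp: edge_label_def Let_def flip_def)
qed

lemma crossings_push:
  assumes "fst l \<in> X" "fst ` set w \<subseteq> X" "v \<in> V"
  shows "crossings (push l w) v = foldr push (edge_label l (foldr act w v)) (crossings w v)"
proof (cases w)
  case (Cons l' w')
  then show ?thesis
    using edge_label_flip[of l "foldr act w' v" "crossings w' v"] assms run_closed[of w' v] reduced_crossings
    by auto
qed simp

text \<open>The cocycle identity: a path that is composed of two crosses the edges of the first and then those
  of the second. On the stabilizer it says that recording crossings is a homomorphism.\<close>

lemma crossings_foldr_push:
  assumes "fst ` set u \<subseteq> X" "fst ` set w \<subseteq> X" "v \<in> V"
  shows "crossings (foldr push u w) v = foldr push (crossings u (foldr act w v)) (crossings w v)"
  using assms(1)
proof (induction u)
  case (Cons l u)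
  then show ?case
    using crossings_push[of l "foldr push u w" v] letters_foldr_push[of u w] assms(2,3)
      run_foldr_push[of u w v] foldr_push_assoc[OF reduced_crossings]
    by simp
qed simp

lemma crossings_rep: "v \<in> V \<Longrightarrow> crossings (rep v) v0 = []"
proof (induction rule: depth_induct)
  case (step v l)
  have l: "act l (act (flip l) v) = v" using act_flip'[OF step(2,1)] .
  have "edge_label l (act (flip l) v) = []"
  proof (cases l)
    case (Pair x b)
    then show ?thesis
      using step(4) l by (cases b) (auto simp: edge_label_def edges_def tree_edge_def flip_def)
  qed
  then show ?case using step by (simp add: run_rep)
qed simp

lemma crossings_inv_rep: 
  assumes "v \<in> V" shows "crossings (inv\<^bsub>F\<^esub> (rep v)) v = []" "foldr act (inv\<^bsub>F\<^esub> (rep v)) v = v0"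
proof -
  interpret F: group F by (rule group_free_group)
  let ?r = "rep v" and ?i = "inv\<^bsub>F\<^esub> (rep v)"
  have r: "?r \<in> carrier F" "?i \<in> carrier F" using rep_in_F[OF assms] by auto
  then have lets: "fst ` set ?r \<subseteq> X" "fst ` set ?i \<subseteq> X" by (auto simp: carrier_free_group)
  have one: "foldr push ?i ?r = []"
    using F.l_inv[OF r(1)] by (simp add: mult_free_group one_free_group)
  show "crossings ?i v = []"
    using crossings_foldr_push[OF lets(2,1) base] one crossings_rep[OF assms] run_rep[OF assms]
    by (simp add: foldr_push_Nil reduced_crossings)
  show "foldr act ?i v = v0"
    using run_foldr_push[OF lets(2,1) base] one run_rep[OF assms] by simp
qed

text \<open>The closed path at \<open>v0\<close> that follows the tree to \<open>v\<close>, takes the step \<open>l\<close> and returns along the tree.\<close>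

definition loop :: "'a \<times> bool \<Rightarrow> 'v \<Rightarrow> 'a word" where
  "loop l v = inv\<^bsub>F\<^esub> (rep (act l v)) \<otimes>\<^bsub>F\<^esub> ([l] \<otimes>\<^bsub>F\<^esub> rep v)"

lemma loop_in_F: "fst l \<in> X \<Longrightarrow> v \<in> V \<Longrightarrow> loop l v \<in> carrier F"
  unfolding loop_def
  by (intro monoid.m_closed[OF group.is_monoid] group.inv_closed group_free_group rep_in_F
      act_closed letter_in_free_group)

lemma loop_flip:
  assumes "fst l \<in> X" "v \<in> V"
  shows "loop (flip l) (act l v) = inv\<^bsub>F\<^esub> (loop l v)"
proof -
  interpret F: group F by (rule group_free_group)
  have "[l] \<in> carrier F" "[flip l] \<in> carrier F" "rep v \<in> carrier F" "rep (act l v) \<in> carrier F"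
    using assms by (auto intro: letter_in_free_group rep_in_F act_closed)
  then show ?thesis
    using assms by (simp add: loop_def act_flip F.inv_mult_group F.m_assoc inv_letter_free_group)
qed

lemma loop_tree:
  assumes "x \<in> X" "v \<in> V" "tree_edge x v"
  shows "loop (x, True) v = \<one>\<^bsub>F\<^esub>"
proof -
  interpret F: group F by (rule group_free_group)
  have av: "act (x, True) v \<in> V" using assms act_closed by simp
  have car: "rep v \<in> carrier F" "rep (act (x, True) v) \<in> carrier F"
    using assms av by (auto intro: rep_in_F)
  have "[(x, True)] \<otimes>\<^bsub>F\<^esub> rep v = rep (act (x, True) v)"
  proof (cases "rep (act (x, True) v) = (x, True) # rep v")
    case True
    then show ?thesis using reduced_rep[OF av] Cons_eq_mult_free_group by metis
  next
    case False
    then have "rep v = (x, False) # rep (act (x, True) v)"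
      using assms by (simp add: tree_edge_def)
    then show ?thesis by (simp add: mult_free_group flip_def)
  qed
  then show ?thesis using car by (simp add: loop_def)
qed

text \<open>Tree paths cross nothing, so the loop of an edge outside of the tree crosses just this edge.\<close>

lemma crossings_loop:
  assumes "fst l \<in> X" "v \<in> V"
  shows "crossings (loop l v) v0 = edge_label l v" "foldr act (loop l v) v0 = v0"
proof -
  have av: "act l v \<in> V" using assms act_closed by simp
  have lets: "fst ` set (inv\<^bsub>F\<^esub> (rep (act l v))) \<subseteq> X" "fst ` set (rep v) \<subseteq> X"
    using group.inv_closed[OF group_free_group rep_in_F[OF av]] rep_letters[OF assms(2)]
    by (auto simp: carrier_free_group)
  have pl: "fst ` set (push l (rep v)) \<subseteq> X"
    using letters_foldr_push[of "[l]" "rep v"] lets(2) assms by simp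
  have run: "foldr act (push l (rep v)) v0 = act l v"
    using run_push[OF assms(1) lets(2) base] run_rep[OF assms(2)] by simp
  have "crossings (push l (rep v)) v0 = edge_label l v"
    using crossings_push[OF assms(1) lets(2) base] run_rep[OF assms(2)] crossings_rep[OF assms(2)]
      edge_label_in_FE[of l v] by (simp add: foldr_push_Nil carrier_free_group)
  then show "crossings (loop l v) v0 = edge_label l v"
    using crossings_foldr_push[OF lets(1) pl base] crossings_inv_rep[OF av] run
    by (simp add: loop_def mult_free_group)
  show "foldr act (loop l v) v0 = v0"
    using run_foldr_push[OF lets(1) pl base] crossings_inv_rep[OF av] run
    by (simp add: loop_def mult_free_group)
qed

lemma subgroup_stabilizer: "subgroup stabilizer F"
proof -
  interpret F: group F by (rule group_free_group)
  show ?thesis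
  proof (rule F.subgroupI)
    show "stabilizer \<subseteq> carrier F" by (auto simp: stabilizer_def)
    show "stabilizer \<noteq> {}" by (auto simp: stabilizer_def carrier_free_group intro!: exI[of _ "[]"])
  next
    fix a assume a: "a \<in> stabilizer"
    then have aF: "a \<in> carrier F" "foldr act a v0 = v0" by (auto simp: stabilizer_def)
    then have "foldr push (inv\<^bsub>F\<^esub> a) a = []"
      using F.l_inv by (simp add: mult_free_group one_free_group)
    moreover have "fst ` set a \<subseteq> X" "fst ` set (inv\<^bsub>F\<^esub> a) \<subseteq> X"
      using aF F.inv_closed[OF aF(1)] by (auto simp: carrier_free_group)
    ultimately have "foldr act (inv\<^bsub>F\<^esub> a) v0 = v0"
      using run_foldr_push[of "inv\<^bsub>F\<^esub> a" a v0] base aF by simp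
    then show "inv\<^bsub>F\<^esub> a \<in> stabilizer" using aF by (simp add: stabilizer_def)
  next
    fix a b assume ab: "a \<in> stabilizer" "b \<in> stabilizer"
    then have "a \<otimes>\<^bsub>F\<^esub> b \<in> carrier F" by (auto simp: stabilizer_def)
    moreover have "foldr act (a \<otimes>\<^bsub>F\<^esub> b) v0 = v0"
      using ab run_foldr_push[of a b v0] base
      by (simp add: stabilizer_def mult_free_group carrier_free_group)
    ultimately show "a \<otimes>\<^bsub>F\<^esub> b \<in> stabilizer" by (simp add: stabilizer_def)
  qed
qed

text \<open>Sending an edge to its loop and recording crossings are inverse to each other. In one direction this
  is checked on the basis; in the other, the loop of the crossings of a path differs from the path only
  by tree paths at both ends, which are empty for a closed path at \<open>v0\<close>.\<close>

theorem stabilizer_free: "\<exists>h. h \<in> iso FE (F\<lparr>carrier := stabilizer\<rparr>)"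
proof -
  interpret F: group F by (rule group_free_group)
  interpret FE: group FE by (rule group_free_group)
  have "\<exists>h\<in>hom FE F. \<forall>e\<in>edges. h [(e, True)] = (\<lambda>(x, v). loop (x, True) v) e"
    by (rule free_group_extend[OF group_free_group]) (auto simp: edges_def loop_in_F)
  then obtain h where h: "h \<in> hom FE F"
    and h_gen: "\<And>x v. (x, v) \<in> edges \<Longrightarrow> h [((x, v), True)] = loop (x, True) v" by auto
  interpret h: group_hom FE F h
    using h by (simp add: group_hom_def group_hom_axioms_def F.is_group FE.is_group)
  let ?S = "(\<lambda>e. [(e, True)]) ` edges"
  have S: "?S \<subseteq> carrier FE" by (auto intro: letter_in_free_group)
  have hS: "h ` ?S \<subseteq> stabilizer"
    using h_gen crossings_loop(2) loop_in_F by (auto simp: stabilizer_def edges_def)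
  have "h ` carrier FE \<subseteq> stabilizer"
    using h.generate_img[OF S] F.generate_subgroup_incl[OF hS subgroup_stabilizer]
    by (simp add: generate_free_group)
  then have h_stab: "h w \<in> stabilizer" if "w \<in> carrier FE" for w using that by blast
  have h_edge_label_pos: "h (edge_label (x, True) v) = loop (x, True) v" if "x \<in> X" "v \<in> V" for x v
    using that h_gen[of x v] loop_tree[of x v] h.hom_one
    by (auto simp: edge_label_def edges_def one_free_group)
  have h_edge_label: "h (edge_label l v) = loop l v" if l: "fst l \<in> X" "v \<in> V" for l v
  proof (cases "snd l")
    case True
    then have "l = (fst l, True)" by (metis prod.collapse)
    then show ?thesis using h_edge_label_pos[of "fst l" v] l by metis
  next
    case False
    let ?u = "act l v" and ?x = "fst l"
    have fl: "flip l = (?x, True)" using False by (simp add: flip_def)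
    have uV: "?u \<in> V" using l act_closed by simp
    have "edge_label l v = inv\<^bsub>FE\<^esub> (edge_label (?x, True) ?u)"
      using False inv_letter_free_group[of "((?x, ?u), True)" edges] FE.inv_one
      by (auto simp: edge_label_def Let_def flip_def one_free_group)
    then have "h (edge_label l v) = inv\<^bsub>F\<^esub> (loop (flip l) ?u)"
      using h_edge_label_pos[of ?x ?u] l uV edge_label_in_FE fl by simp
    also have "\<dots> = loop l v"
      using loop_flip[of l v] l loop_in_F[of l v] by simp
    finally show ?thesis .
  qed
  have h_crossings: "h (crossings w v) = inv\<^bsub>F\<^esub> (rep (foldr act w v)) \<otimes>\<^bsub>F\<^esub> (w \<otimes>\<^bsub>F\<^esub> rep v)"
    if "w \<in> carrier F" "v \<in> V" for w v
    using that(1)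
  proof (induction w)
    case Nil
    then show ?case using rep_in_F[OF that(2)] h.hom_one F.l_inv[OF rep_in_F[OF that(2)]] 
      by (simp add: one_free_group mult_free_group)
  next
    case (Cons l w)
    have w: "w \<in> carrier F" "fst l \<in> X" "reduced (l # w)" "fst ` set w \<subseteq> X"
      using Cons.prems by (auto simp: carrier_free_group reduced_Cons)
    let ?u = "foldr act w v"
    have uV: "?u \<in> V" by (rule run_closed[OF w(4) that(2)])
    have car: "[l] \<in> carrier F" "rep v \<in> carrier F" "rep ?u \<in> carrier F" "rep (act l ?u) \<in> carrier F"
      using w uV that by (auto intro: letter_in_free_group rep_in_F act_closed)
    have "h (crossings (l # w) v) = h (edge_label l ?u \<otimes>\<^bsub>FE\<^esub> crossings w v)"
      by (simp only: mult_free_group crossings.simps)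
    also have "\<dots> = loop l ?u \<otimes>\<^bsub>F\<^esub> h (crossings w v)"
      using h_edge_label[OF w(2) uV] edge_label_in_FE crossings_in_FE by simp
    also have "\<dots> = loop l ?u \<otimes>\<^bsub>F\<^esub> (inv\<^bsub>F\<^esub> (rep ?u) \<otimes>\<^bsub>F\<^esub> (w \<otimes>\<^bsub>F\<^esub> rep v))"
      using Cons.IH w by simp
    also have "\<dots> = inv\<^bsub>F\<^esub> (rep (act l ?u)) \<otimes>\<^bsub>F\<^esub> ([l] \<otimes>\<^bsub>F\<^esub> (rep ?u \<otimes>\<^bsub>F\<^esub> (inv\<^bsub>F\<^esub> (rep ?u) \<otimes>\<^bsub>F\<^esub> (w \<otimes>\<^bsub>F\<^esub> rep v))))"
      using car w by (simp add: loop_def F.m_assoc)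
    also have "rep ?u \<otimes>\<^bsub>F\<^esub> (inv\<^bsub>F\<^esub> (rep ?u) \<otimes>\<^bsub>F\<^esub> (w \<otimes>\<^bsub>F\<^esub> rep v)) = w \<otimes>\<^bsub>F\<^esub> rep v"
      using car w by (simp add: F.m_assoc[symmetric])
    also have "[l] \<otimes>\<^bsub>F\<^esub> (w \<otimes>\<^bsub>F\<^esub> rep v) = (l # w) \<otimes>\<^bsub>F\<^esub> rep v"
      using car w Cons_eq_mult_free_group[OF w(3), of X] by (simp add: F.m_assoc)
    finally show ?case by simp
  qed
  have h_crossings_stab: "h (crossings w v0) = w" if "w \<in> stabilizer" for w
  proof -
    have w: "w \<in> carrier F" "foldr act w v0 = v0" using that by (auto simp: stabilizer_def)
    have "h (crossings w v0) = inv\<^bsub>F\<^esub> \<one>\<^bsub>F\<^esub> \<otimes>\<^bsub>F\<^esub> (w \<otimes>\<^bsub>F\<^esub> \<one>\<^bsub>F\<^esub>)"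
      using h_crossings[OF w(1) base] w(2) by (simp add: one_free_group)
    then show ?thesis using w by simp
  qed
  have "crossings (h w) v0 = w" if "w \<in> carrier FE" for w
  proof (rule free_group_hom_eq[OF FE.is_group _ _ _ that, of "\<lambda>w. crossings (h w) v0" "\<lambda>w. w"])
    show "(\<lambda>w. crossings (h w) v0) \<in> hom FE FE"
    proof (rule homI)
      fix u w assume uw: "u \<in> carrier FE" "w \<in> carrier FE"
      have st: "h u \<in> stabilizer" "h w \<in> stabilizer" using uw h_stab by auto
      then show "crossings (h (u \<otimes>\<^bsub>FE\<^esub> w)) v0 = crossings (h u) v0 \<otimes>\<^bsub>FE\<^esub> crossings (h w) v0"
        using crossings_foldr_push[of "h u" "h w" v0] base h.hom_mult[OF uw]
        by (simp add: mult_free_group[where X = X] mult_free_group[where u = "crossings _ _"]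
            stabilizer_def carrier_free_group[where X = X])
    qed (rule crossings_in_FE)
    show "(\<lambda>w. w) \<in> hom FE FE" by (rule homI) auto
  next
    fix e assume e: "e \<in> edges"
    then obtain x v where xv: "e = (x, v)" "x \<in> X" "v \<in> V" by (auto simp: edges_def)
    then show "crossings (h [(e, True)]) v0 = [(e, True)]"
      using h_gen[of x v] e crossings_loop(1)[of "(x, True)" v] by (simp add: edge_label_def)
  qed
  then have inj: "inj_on h (carrier FE)" by (rule inj_on_inverseI)
  have surj: "h ` carrier FE = stabilizer"
  proof
    show "stabilizer \<subseteq> h ` carrier FE"
    proof
      fix w assume "w \<in> stabilizer"
      then have "w = h (crossings w v0)" using h_crossings_stab by simp
      then show "w \<in> h ` carrier FE" using crossings_in_FE by blast
    qed
  qed (use h_stab in blast)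
  have "h \<in> hom FE (F\<lparr>carrier := stabilizer\<rparr>)"
    using h_stab by (intro homI) simp_all
  then have "h \<in> iso FE (F\<lparr>carrier := stabilizer\<rparr>)"
    using inj surj by (simp add: iso_iff)
  then show ?thesis by blast
qed

end

text \<open>The Nielsen-Schreier theorem with Schreier's index formula. The free group acts on the right cosets of
  \<open>U\<close> in \<open>Q\<close>, and the preimage of \<open>U\<close> is the stabilizer of the coset \<open>U\<close>. The form with an epimorphism \<open>f\<close>
  serves subgroups of the free group, subgroups of an isomorphic copy and kernels of epimorphisms to
  finite groups alike.\<close>

theorem preimage_free:
  fixes X :: "'a set" and U :: "'b set" and Q (structure)
  assumes "group Q" and f: "f \<in> hom (free_group X) Q" and surj: "f ` carrier (free_group X) = carrier Q"
    and U: "subgroup U Q"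
  obtains E :: "('a \<times> 'b set) set" and h
  where "subgroup {w \<in> carrier (free_group X). f w \<in> U} (free_group X)"
    and "h \<in> iso (free_group E) (free_group X\<lparr>carrier := {w \<in> carrier (free_group X). f w \<in> U}\<rparr>)"
    and "finite X \<Longrightarrow> finite (rcosets U) \<Longrightarrow> finite E \<and> card E + card (rcosets U) = card X * card (rcosets U) + 1"
proof -
  let ?F = "free_group X"
  interpret F: group ?F by (rule group_free_group)
  interpret Q: group Q by fact
  interpret f: group_hom ?F Q f
    using f by (simp add: group_hom_def group_hom_axioms_def F.is_group Q.is_group)
  \<comment> \<open>The inverse letter turns right multiplication into a left action.\<close>
  define act where "act l c = c #> f [flip l]" for l :: "'a \<times> bool" and c
  have Uc: "U \<subseteq> carrier Q" by (rule subgroup.subset[OF U])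
  have V: "\<exists>w\<in>carrier ?F. c = U #> f w" if "c \<in> rcosets U" for c
  proof -
    obtain x where x: "x \<in> carrier Q" "c = U #> x" using \<open>c \<in> rcosets U\<close> by (auto simp: RCOSETS_def)
    then show ?thesis using surj by (metis imageE)
  qed
  have act: "act l (U #> f w) = U #> f (w \<otimes>\<^bsub>?F\<^esub> [flip l])"
    if "fst l \<in> X" "w \<in> carrier ?F" for l :: "'a \<times> bool" and w
    using that Uc letter_in_free_group[of "flip l" X] by (simp add: act_def Q.coset_mult_assoc)
  have run: "foldr act w U = U #> inv (f w)" if "w \<in> carrier ?F" for w
    using that
  proof (induction w)
    case Nil
    then show ?case using Q.coset_mult_one[OF Uc] f.hom_one by (simp add: one_free_group)
  next
    case (Cons l w)
    have w: "w \<in> carrier ?F" "fst l \<in> X" "reduced (l # w)"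
      using Cons.prems by (auto simp: carrier_free_group reduced_Cons)
    have l: "[l] \<in> carrier ?F" using w by (simp add: letter_in_free_group)
    have "inv (f (l # w)) = f (inv\<^bsub>?F\<^esub> w \<otimes>\<^bsub>?F\<^esub> [flip l])"
      unfolding Cons_eq_mult_free_group[OF w(3), of X] inv_letter_free_group[OF w(2), symmetric]
      using w l by (simp add: Q.inv_mult_group)
    then show ?case using Cons.IH[OF w(1)] act[OF w(2), of "inv\<^bsub>?F\<^esub> w"] w(1) by simp
  qed
  interpret free_group_action X "rcosets U" act U
  proof
    fix l :: "'a \<times> bool" and c assume l: "fst l \<in> X" and "c \<in> rcosets U"
    then obtain w where w: "w \<in> carrier ?F" "c = U #> f w" using V by blast
    have lF: "[l] \<in> carrier ?F" "[flip l] \<in> carrier ?F" using l by (auto intro: letter_in_free_group)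
    have wl: "w \<otimes>\<^bsub>?F\<^esub> [flip l] \<in> carrier ?F" using w lF by simp
    show "act l c \<in> rcosets U"
      using act[OF l w(1)] w(2) Q.rcosetsI[OF Uc f.hom_closed[OF wl]] by simp
    have "[flip l] \<otimes>\<^bsub>?F\<^esub> [l] = \<one>\<^bsub>?F\<^esub>" by (simp add: mult_free_group one_free_group)
    then have "w \<otimes>\<^bsub>?F\<^esub> [flip l] \<otimes>\<^bsub>?F\<^esub> [l] = w"
      using w lF by (simp add: F.m_assoc del: f.hom_mult)
    then show "act (flip l) (act l c) = c"
      using act[OF l w(1)] act[OF _ wl, of "flip l"] w l by simp
  next
    show "U \<in> rcosets U" by (rule subgroup.subgroup_in_rcosets[OF U Q.is_group])
  next
    fix c assume "c \<in> rcosets U"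
    then obtain w where w: "w \<in> carrier ?F" "c = U #> f w" using V by blast
    then have "foldr act (inv\<^bsub>?F\<^esub> w) U = c" using run[of "inv\<^bsub>?F\<^esub> w"] by simp
    moreover have "fst ` set (inv\<^bsub>?F\<^esub> w) \<subseteq> X"
      using F.inv_closed[OF w(1)] by (simp add: carrier_free_group)
    ultimately show "\<exists>w. fst ` set w \<subseteq> X \<and> foldr act w U = c" by blast
  qed
  have fix_iff: "U #> inv x = U \<longleftrightarrow> x \<in> U" if x: "x \<in> carrier Q" for x
  proof
    assume "U #> inv x = U"
    then have "inv x \<in> U" using Q.rcos_self[of "inv x" U] U x by simp
    then show "x \<in> U" using subgroup.m_inv_closed[OF U, of "inv x"] x by simp
  next
    assume "x \<in> U"
    then show "U #> inv x = U"
      using Q.coset_join2[of "inv x" U] U x by (simp add: subgroup.m_inv_closed)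
  qed
  have "foldr act w U = U \<longleftrightarrow> f w \<in> U" if "w \<in> carrier ?F" for w
    using run[OF that] fix_iff[OF f.hom_closed[OF that]] by simp
  then have stab: "stabilizer = {w \<in> carrier ?F. f w \<in> U}"
    unfolding stabilizer_def by blast
  from stabilizer_free obtain h where "h \<in> iso FE (?F\<lparr>carrier := stabilizer\<rparr>)" by auto
  then show thesis
    using card_edges subgroup_stabilizer stab by (intro that) auto
qed

corollary nielsen_schreier:
  fixes U :: "'a word set"
  assumes U: "subgroup U (free_group X)"
  obtains E :: "('a \<times> 'a word set) set" and h
  where "h \<in> iso (free_group E) (free_group X\<lparr>carrier := U\<rparr>)"
proof -
  let ?F = "free_group X"
  have "{w \<in> carrier ?F. w \<in> U} = U" using subgroup.subset[OF U] by auto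
  moreover have "(\<lambda>w. w) \<in> hom ?F ?F" by (rule homI) auto
  ultimately show thesis
    using preimage_free[of ?F "\<lambda>w. w" X U] group_free_group[of X] U that by auto
qed

section \<open>Ranks in central extensions of free groups\<close>

lemma (in group) gens_le_restrict:
  assumes "subgroup C G" and "K \<subseteq> C"
  shows "gens_le (G\<lparr>carrier := C\<rparr>) K k \<longleftrightarrow> gens_le G K k"
proof -
  have *: "S \<subseteq> K \<Longrightarrow> generate (G\<lparr>carrier := C\<rparr>) S = generate G S" for S
    using generate_consistent[OF _ assms(1)] assms(2) by auto
  show ?thesis unfolding gens_le_def by (rule ex_cong1) (use * in auto)
qed

text \<open>A group with at most one generator is commutative.\<close>

lemma (in group) gens_le_cyclic_subgroup:
  assumes P: "subgroup P G" "gens_le G P k" "k \<le> 1" and U: "subgroup U G" "U \<subseteq> P"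
  shows "gens_le G U k"
proof -
  obtain S where S: "finite S" "S \<subseteq> P" "generate G S = P" "card S \<le> k"
    using P(2) by (auto simp: gens_le_def)
  obtain a where a: "a \<in> carrier G" "S \<subseteq> {a}"
  proof (cases "S = {}")
    case True
    then show ?thesis using that[of \<one>] by simp
  next
    case False
    then have "card S = 1" using S P(3) by (simp add: card_gt_0_iff Suc_leI le_antisym)
    then obtain b where "S = {b}" by (auto simp: card_1_singleton_iff)
    then show ?thesis using that[of b] S(2) subgroup.subset[OF P(1)] by auto
  qed
  have "P \<subseteq> generate G {a}" using mono_generate[OF a(2)] S(3) by simp
  then have pow: "\<exists>i::int. x = a [^] i" if "x \<in> P" for x
    using that generate_pow[OF a(1)] by auto
  have "x \<otimes> y = y \<otimes> x" if xy: "x \<in> P" "y \<in> P" for x y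
  proof -
    obtain i j :: int where "x = a [^] i" "y = a [^] j" using pow xy by blast
    then show ?thesis using a(1) by (simp add: int_pow_mult[symmetric] add.commute)
  qed
  then interpret P: comm_group "G\<lparr>carrier := P\<rparr>"
    by (intro group.group_comm_groupI subgroup_imp_group[OF P(1)]) simp_all
  have "subgroup U (G\<lparr>carrier := P\<rparr>)" by (rule subgroup_incl[OF U(1) P(1) U(2)])
  then have "gens_le (G\<lparr>carrier := P\<rparr>) U k"
    using P.gens_le_subgroup[of P k U] P(2) U(2) gens_le_restrict[OF P(1), of P k] by simp
  then show ?thesis using gens_le_restrict[OF P(1) U(2)] by simp
qed

text \<open>Representatives of the cosets, added to generators of \<open>U\<close>, generate.\<close>

lemma (in group) gens_le_finite_index:
  assumes U: "subgroup U G" "gens_le G U k" and fin: "finite (rcosets U)"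
  shows "\<exists>k'. gens_le G (carrier G) k'"
proof -
  obtain S where S: "finite S" "S \<subseteq> U" "generate G S = U"
    using U(2) by (auto simp: gens_le_def)
  have Uc: "U \<subseteq> carrier G" by (rule subgroup.subset[OF U(1)])
  have "\<forall>c\<in>rcosets U. \<exists>x\<in>carrier G. c = U #> x" by (auto simp: RCOSETS_def)
  then obtain r where r: "\<And>c. c \<in> rcosets U \<Longrightarrow> r c \<in> carrier G"
    "\<And>c. c \<in> rcosets U \<Longrightarrow> c = U #> r c" by metis
  let ?T = "S \<union> r ` (rcosets U)"
  have Tc: "?T \<subseteq> carrier G" using S(2) Uc r(1) by auto
  have "x \<in> generate G ?T" if x: "x \<in> carrier G" for x
  proof -
    have c: "U #> x \<in> rcosets U" by (rule rcosetsI[OF Uc x])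
    have "x \<in> U #> r (U #> x)" using rcos_self[OF x U(1)] r(2)[OF c] by simp
    then obtain u where u: "u \<in> U" "x = u \<otimes> r (U #> x)" by (auto simp: r_coset_def)
    have "u \<in> generate G ?T" using mono_generate[of S ?T] S(3) u(1) by auto
    moreover have "r (U #> x) \<in> generate G ?T" using c by (intro generate.incl) auto
    ultimately have "u \<otimes> r (U #> x) \<in> generate G ?T" by (rule generate.eng)
    then show ?thesis using u(2) by simp
  qed
  then have "generate G ?T = carrier G" using generate_incl[OF Tc] by auto
  then have "gens_le G (carrier G) (card ?T)"
    using S(1) fin Tc by (intro gens_leI[of ?T]) simp_all
  then show ?thesis ..
qed

locale central_extension_of_free = group G + pi: group_hom G "free_group X" pi
  for G (structure) and X :: "'b set" and pi +
  assumes central: "z \<in> carrier G \<Longrightarrow> pi z = \<one>\<^bsub>free_group X\<^esub> \<Longrightarrow> g \<in> carrier G \<Longrightarrow> z \<otimes> g = g \<otimes> z"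
begin

abbreviation F where "F \<equiv> free_group X"

definition kernel_part :: "'a set \<Rightarrow> 'a set" where
  "kernel_part K = {x \<in> K. pi x = \<one>\<^bsub>F\<^esub>}"

abbreviation C where "C \<equiv> kernel_part (carrier G)"

lemma subgroup_C: "subgroup C G"
  using pi.subgroup_kernel by (simp add: kernel_part_def kernel_def)

lemma subgroup_kernel_part: "subgroup K G \<Longrightarrow> subgroup (kernel_part K) G"
proof -
  assume K: "subgroup K G"
  then have "kernel_part K = K \<inter> C" using subgroup.subset by (fastforce simp: kernel_part_def)
  then show ?thesis using subgroups_Inter_pair[OF K subgroup_C] by simp
qed

lemma comm_group_C: "comm_group (G\<lparr>carrier := C\<rparr>)"
  using central by (intro group.group_comm_groupI subgroup_imp_group[OF subgroup_C])
    (simp_all add: kernel_part_def)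

lemma kernel_part_subset: "subgroup K G \<Longrightarrow> kernel_part K \<subseteq> C"
  using subgroup.subset[of K G] by (auto simp: kernel_part_def)

lemma kernel_part_gens_mono:
  assumes K: "subgroup K G" "gens_le G (kernel_part K) k" and M: "subgroup M G" "M \<subseteq> K"
  shows "gens_le G (kernel_part M) k"
proof -
  interpret C: comm_group "G\<lparr>carrier := C\<rparr>" by (rule comm_group_C)
  note KC = kernel_part_subset[OF K(1)] and MC = kernel_part_subset[OF M(1)]
  have MK: "kernel_part M \<subseteq> kernel_part K" using M(2) by (auto simp: kernel_part_def)
  have "subgroup (kernel_part M) (G\<lparr>carrier := C\<rparr>)"
    by (rule subgroup_incl[OF subgroup_kernel_part[OF M(1)] subgroup_C MC])
  then have "gens_le (G\<lparr>carrier := C\<rparr>) (kernel_part M) k"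
    using C.gens_le_subgroup[of "kernel_part K" k "kernel_part M"] K(2) MK KC
      gens_le_restrict[OF subgroup_C KC] by simp
  then show ?thesis using gens_le_restrict[OF subgroup_C MC] by simp
qed

text \<open>The image of \<open>K\<close> is free, so \<open>pi\<close> splits over it: basis elements may be lifted arbitrarily.\<close>

lemma section_exists:
  assumes K: "subgroup K G" and h: "h \<in> iso (free_group E) (F\<lparr>carrier := pi ` K\<rparr>)"
  obtains s where "s \<in> hom (free_group E) G" "\<And>w. w \<in> carrier (free_group E) \<Longrightarrow> s w \<in> K"
    "\<And>w. w \<in> carrier (free_group E) \<Longrightarrow> pi (s w) = h w"
proof -
  let ?FE = "free_group E" and ?GK = "G\<lparr>carrier := K\<rparr>"
  have GK: "group ?GK" by (rule subgroup_imp_group[OF K])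
  have hK: "h w \<in> pi ` K" if "w \<in> carrier ?FE" for w
    using h that by (auto simp: iso_iff)
  have "\<exists>k\<in>K. pi k = h [(e, True)]" if "e \<in> E" for e
    using hK[of "[(e, True)]"] letter_in_free_group[of "(e, True)" E] that by auto
  then obtain g where g: "\<And>e. e \<in> E \<Longrightarrow> g e \<in> K" "\<And>e. e \<in> E \<Longrightarrow> pi (g e) = h [(e, True)]"
    by metis
  have "\<exists>s\<in>hom ?FE ?GK. \<forall>e\<in>E. s [(e, True)] = g e"
    by (rule free_group_extend[OF GK]) (use g in auto)
  then obtain s where s: "s \<in> hom ?FE ?GK" "\<And>e. e \<in> E \<Longrightarrow> s [(e, True)] = g e" by blast
  have sK: "s w \<in> K" if "w \<in> carrier ?FE" for w
    using hom_in_carrier[OF s(1) that] by simp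
  have sG: "s \<in> hom ?FE G"
    using sK subgroup.mem_carrier[OF K] hom_mult[OF s(1)] by (intro homI) simp_all
  have "pi (s w) = h w" if "w \<in> carrier ?FE" for w
  proof (rule free_group_hom_eq[OF group_free_group _ _ _ that, of "\<lambda>w. pi (s w)" X h])
    show "(\<lambda>w. pi (s w)) \<in> hom ?FE F"
      using Group.hom_compose[OF sG pi.homh] by (simp add: comp_def)
    have hh: "h \<in> hom ?FE (F\<lparr>carrier := pi ` K\<rparr>)" using h by (simp add: iso_def)
    have piK: "pi ` K \<subseteq> carrier F" using subgroup.subset[OF pi.subgroup_img_is_subgroup[OF K]] .
    show "h \<in> hom ?FE F"
    proof (rule homI)
      show "h x \<in> carrier F" if "x \<in> carrier ?FE" for x using hK[OF that] piK by blast
      show "h (x \<otimes>\<^bsub>?FE\<^esub> y) = h x \<otimes>\<^bsub>F\<^esub> h y" if "x \<in> carrier ?FE" "y \<in> carrier ?FE" for x y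
        using hom_mult[OF hh that] by simp
    qed
  qed (use s g in simp)
  then show thesis using that sG sK by blast
qed

text \<open>The section \<open>sec\<close> splits \<open>K\<close> as the product of its part in the central kernel and a free group on \<open>E\<close>. The
  projection \<open>rho\<close> to the first factor is a homomorphism because this factor is central. Together with
  the \<open>card E\<close> exponent sums it maps \<open>K\<close> to a commutative group \<open>B\<close>, where the part of \<open>K\<close> in the kernel
  is cut out by the vanishing of the exponent sums, each of which saves one generator.\<close>

lemma rank_splits:
  assumes K: "subgroup K G" and gens: "gens_le G K s"
  obtains k r where "gens_le G (kernel_part K) k" "gens_le F (pi ` K) r" "k + r \<le> s"
proof -
  let ?GK = "G\<lparr>carrier := K\<rparr>"
  have GK: "group ?GK" by (rule subgroup_imp_group[OF K])
  have Kc: "K \<subseteq> carrier G" by (rule subgroup.subset[OF K])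
  have piK: "subgroup (pi ` K) F" by (rule pi.subgroup_img_is_subgroup[OF K])
  obtain E :: "('b \<times> 'b word set) set" and h where h: "h \<in> iso (free_group E) (F\<lparr>carrier := pi ` K\<rparr>)"
    by (rule nielsen_schreier[OF piK])
  let ?FE = "free_group E"
  interpret FE: group ?FE by (rule group_free_group)
  have gens_pi: "gens_le F (pi ` K) s" by (rule pi.gens_le_image[OF gens Kc])
  have E: "finite E" using free_basis_le_gens[OF group_free_group piK h gens_pi] by simp
  obtain sec where sec: "sec \<in> hom ?FE G" "\<And>w. w \<in> carrier ?FE \<Longrightarrow> sec w \<in> K"
    "\<And>w. w \<in> carrier ?FE \<Longrightarrow> pi (sec w) = h w"
    using section_exists[OF K h] by blast
  interpret sec: group_hom ?FE G sec
    using sec(1) by (simp add: group_hom_def group_hom_axioms_def)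
  \<comment> \<open>\<open>q\<close> is \<open>pi\<close>, read in the free group on the basis \<open>E\<close>.\<close>
  define q where "q x = inv_into (carrier ?FE) h (pi x)" for x
  have h_inj: "inj_on h (carrier ?FE)" and h_surj: "h ` carrier ?FE = pi ` K"
    and h_hom: "h \<in> hom ?FE (F\<lparr>carrier := pi ` K\<rparr>)" using h by (auto simp: iso_iff)
  have q: "q x \<in> carrier ?FE" "h (q x) = pi x" if "x \<in> K" for x
    using that h_surj by (auto simp: q_def intro: inv_into_into f_inv_into_f)
  have q_unique: "q x = w" if "x \<in> K" "w \<in> carrier ?FE" "pi x = h w" for x w
    using inv_into_f_f[OF h_inj that(2)] that(3) by (simp add: q_def)
  have q_mult: "q (x \<otimes> y) = q x \<otimes>\<^bsub>?FE\<^esub> q y" if "x \<in> K" "y \<in> K" for x y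
  proof (rule q_unique)
    show "x \<otimes> y \<in> K" using that K by (simp add: subgroup.m_closed)
    show "q x \<otimes>\<^bsub>?FE\<^esub> q y \<in> carrier ?FE" using q that by simp
    show "pi (x \<otimes> y) = h (q x \<otimes>\<^bsub>?FE\<^esub> q y)"
      using hom_mult[OF h_hom q(1)[OF that(1)] q(1)[OF that(2)]] q that Kc by (simp add: subset_iff)
  qed
  define rho where "rho x = x \<otimes> inv (sec (q x))" for x
  have rho_mem: "rho x \<in> kernel_part K" if "x \<in> K" for x
  proof -
    have "rho x \<in> K" using q[OF that] sec(2) that K
      by (simp add: rho_def subgroup.m_closed subgroup.m_inv_closed)
    moreover have "pi (rho x) = \<one>\<^bsub>F\<^esub>"
      using q[OF that] sec(3)[of "q x"] that Kc by (auto simp: rho_def subset_iff)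
    ultimately show ?thesis by (simp add: kernel_part_def)
  qed
  have rho_eq: "x = rho x \<otimes> sec (q x)" if "x \<in> K" for x
    using that Kc q[OF that] by (auto simp: rho_def m_assoc subset_iff)
  have rho_C: "rho x \<in> carrier G" "pi (rho x) = \<one>\<^bsub>F\<^esub>" if "x \<in> K" for x
    using rho_mem[OF that] Kc by (auto simp: kernel_part_def)
  have rho_mult: "rho (x \<otimes> y) = rho x \<otimes> rho y" if "x \<in> K" "y \<in> K" for x y
  proof -
    have c: "x \<in> carrier G" "y \<in> carrier G" "sec (q x) \<in> carrier G" "sec (q y) \<in> carrier G"
      using that Kc q by auto
    have "rho (x \<otimes> y) = x \<otimes> rho y \<otimes> inv (sec (q x))"
      using q that c by (simp add: rho_def q_mult inv_mult_group m_assoc)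
    also have "\<dots> = rho y \<otimes> x \<otimes> inv (sec (q x))"
      using central[OF rho_C[OF that(2)] c(1)] by simp
    also have "\<dots> = rho y \<otimes> rho x"
      using rho_C[OF that(2)] c by (simp add: rho_def m_assoc)
    also have "\<dots> = rho x \<otimes> rho y"
      using central[OF rho_C[OF that(2)] rho_C(1)[OF that(1)]] .
    finally show ?thesis .
  qed
  have "\<exists>c\<in>hom ?FE integer_group. \<forall>x\<in>E. c [(x, True)] = (if x = e then 1 else 0)" for e
    by (rule free_group_extend) auto
  then obtain chi where chi: "\<And>e. chi e \<in> hom ?FE integer_group"
    and chi_dual: "\<And>e x. x \<in> E \<Longrightarrow> chi e [(x, True)] = (if x = e then 1 else 0)" by metis
  let ?ZE = "product_group E (\<lambda>_. integer_group)"
  define B where "B = G\<lparr>carrier := C\<rparr> \<times>\<times> ?ZE"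
  have grpB: "group B" unfolding B_def
    by (intro DirProd_group subgroup_imp_group subgroup_C product_group) simp
  interpret B: comm_group B
  proof (rule group.group_comm_groupI[OF grpB])
    fix x y assume xy: "x \<in> carrier B" "y \<in> carrier B"
    show "x \<otimes>\<^bsub>B\<^esub> y = y \<otimes>\<^bsub>B\<^esub> x"
      using comm_group.axioms(1)[OF comm_group_C] comm_monoid.m_comm[of "G\<lparr>carrier := C\<rparr>" "fst x" "fst y"] xy
      by (auto simp: B_def mult_DirProd' add.commute)
  qed
  define Psi where "Psi x = (rho x, \<lambda>e\<in>E. chi e (q x))" for x
  have Psi_hom: "Psi \<in> hom ?GK B"
  proof (rule homI)
    fix x assume "x \<in> carrier ?GK"
    then show "Psi x \<in> carrier B"
      using rho_C by (auto simp: Psi_def B_def kernel_part_def)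
  next
    fix x y assume "x \<in> carrier ?GK" "y \<in> carrier ?GK"
    then show "Psi (x \<otimes>\<^bsub>?GK\<^esub> y) = Psi x \<otimes>\<^bsub>B\<^esub> Psi y"
      using rho_mult q_mult hom_mult[OF chi] q by (auto simp: Psi_def B_def)
  qed
  then interpret Psi: group_hom ?GK B Psi
    using GK by (simp add: group_hom_def group_hom_axioms_def grpB)
  have gPsi: "gens_le B (Psi ` K) s"
    using Psi.gens_le_image[of K s] gens gens_le_restrict[OF K, of K s] by simp
  have PsiK: "Psi ` K \<subseteq> carrier B" using Psi.hom_closed by auto
  have q_sec: "q (sec w) = w" if "w \<in> carrier ?FE" for w
    using q_unique[of "sec w" w] sec that by simp
  have rho_sec: "rho (sec w) = \<one>" if "w \<in> carrier ?FE" for w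
    using q_sec that by (simp add: rho_def)
  have letter: "[(e, True)] \<in> carrier ?FE" if "e \<in> E" for e
    using that by (simp add: letter_in_free_group)
  have "\<exists>k. k + card E \<le> s \<and> gens_le B {x \<in> Psi ` K. \<forall>e\<in>E. snd x e = 0} k"
  proof (rule B.gens_le_common_kernel[OF E _ gPsi PsiK, of "\<lambda>e x. snd x e" "\<lambda>e. Psi (sec [(e, True)])"])
    show "(\<lambda>x. snd x e) \<in> hom B integer_group" if "e \<in> E" for e
      using that by (intro homI) (auto simp: B_def mult_DirProd')
    show "Psi (sec [(e, True)]) \<in> Psi ` K" if "e \<in> E" for e
      using sec(2) letter that by simp
    show "snd (Psi (sec [(j, True)])) i = (if i = j then 1 else 0)" if "i \<in> E" "j \<in> E" for i j
      using that q_sec[OF letter[of j]] chi_dual[of j i] by (auto simp: Psi_def)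
  qed
  then obtain k where k: "k + card E \<le> s" "gens_le B {x \<in> Psi ` K. \<forall>e\<in>E. snd x e = 0} k" by blast
  have "fst \<in> hom B G"
    by (rule homI) (auto simp: B_def mult_DirProd' kernel_part_def)
  then interpret fst: group_hom B G fst
    by (simp add: group_hom_def group_hom_axioms_def grpB)
  have "fst ` {x \<in> Psi ` K. \<forall>e\<in>E. snd x e = 0} = kernel_part K"
  proof
    show "fst ` {x \<in> Psi ` K. \<forall>e\<in>E. snd x e = 0} \<subseteq> kernel_part K"
      using rho_mem by (auto simp: Psi_def)
    show "kernel_part K \<subseteq> fst ` {x \<in> Psi ` K. \<forall>e\<in>E. snd x e = 0}"
    proof
      fix x assume x: "x \<in> kernel_part K"
      then have xK: "x \<in> K" "pi x = \<one>\<^bsub>F\<^esub>" by (auto simp: kernel_part_def)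
      have "h \<one>\<^bsub>?FE\<^esub> = \<one>\<^bsub>F\<^esub>"
        using sec(3)[of "\<one>\<^bsub>?FE\<^esub>"] by simp
      then have q1: "q x = \<one>\<^bsub>?FE\<^esub>" using q_unique[OF xK(1), of "\<one>\<^bsub>?FE\<^esub>"] xK(2) by simp
      have "chi e (q x) = 0" for e
        using hom_one[OF chi[of e] FE.is_group] q1 by simp
      then have "\<forall>e\<in>E. snd (Psi x) e = 0" by (simp add: Psi_def)
      moreover have "fst (Psi x) = x" using q1 xK Kc by (auto simp: Psi_def rho_def)
      ultimately show "x \<in> fst ` {x \<in> Psi ` K. \<forall>e\<in>E. snd x e = 0}" using xK(1) by force
    qed
  qed
  moreover have "gens_le G (fst ` {x \<in> Psi ` K. \<forall>e\<in>E. snd x e = 0}) k"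
    by (rule fst.gens_le_image[OF k(2)]) (use PsiK in auto)
  ultimately have "gens_le G (kernel_part K) k" by simp
  then show thesis using that free_basis_gens_le[OF group_free_group piK h E] k(1) by blast
qed

end

section \<open>Finite index\<close>

lemma iso_onto_image_of_part:
  assumes h: "h \<in> iso E (A\<lparr>carrier := W\<rparr>)" and W: "W \<subseteq> carrier A"
    and f: "f \<in> hom A B" and inj: "inj_on f W"
  shows "f \<circ> h \<in> iso E (B\<lparr>carrier := f ` W\<rparr>)"
proof -
  have hh: "h \<in> hom E (A\<lparr>carrier := W\<rparr>)" "h ` carrier E = W" "inj_on h (carrier E)"
    using h by (auto simp: iso_iff)
  have hW: "h x \<in> W" if "x \<in> carrier E" for x using hh(2) that by blast
  have "f \<circ> h \<in> hom E (B\<lparr>carrier := f ` W\<rparr>)"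
  proof (rule homI)
    show "(f \<circ> h) x \<in> carrier (B\<lparr>carrier := f ` W\<rparr>)" if "x \<in> carrier E" for x
      using hW[OF that] by simp
    show "(f \<circ> h) (x \<otimes>\<^bsub>E\<^esub> y) = (f \<circ> h) x \<otimes>\<^bsub>B\<lparr>carrier := f ` W\<rparr>\<^esub> (f \<circ> h) y"
      if "x \<in> carrier E" "y \<in> carrier E" for x y
      using hom_mult[OF hh(1) that] hom_mult[OF f subsetD[OF W hW[OF that(1)]] subsetD[OF W hW[OF that(2)]]]
      by simp
  qed
  moreover have "(f \<circ> h) ` carrier E = f ` W" by (simp only: image_comp[symmetric] hh(2))
  moreover have "inj_on (f \<circ> h) (carrier E)" using hh inj by (simp add: comp_inj_on)
  ultimately show ?thesis by (simp add: iso_iff)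
qed

text \<open>With equality this is Schreier's index formula; the inequality suffices for estimates. That \<open>P\<close> is
  finitely generated is a conclusion, which will be applied to an intersection of subgroups of which
  only a subgroup of finite index is known to be finitely generated.\<close>

lemma schreier_rank_bound:
  fixes X :: "'b set"
  defines "F \<equiv> free_group X"
  assumes P: "subgroup P F" and U: "subgroup U F" "U \<subseteq> P" "gens_le F U u"
    and fin: "finite (rcosets\<^bsub>F\<lparr>carrier := P\<rparr>\<^esub> U)"
  shows "finitely_generated (F\<lparr>carrier := P\<rparr>)"
    "group_rank (F\<lparr>carrier := U\<rparr>) + card (rcosets\<^bsub>F\<lparr>carrier := P\<rparr>\<^esub> U)
       \<le> card (rcosets\<^bsub>F\<lparr>carrier := P\<rparr>\<^esub> U) * group_rank (F\<lparr>carrier := P\<rparr>) + 1"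
proof -
  interpret F: group F unfolding F_def by (rule group_free_group)
  let ?FP = "F\<lparr>carrier := P\<rparr>"
  interpret FP: group ?FP by (rule F.subgroup_imp_group[OF P])
  have UFP: "subgroup U ?FP" by (rule F.subgroup_incl[OF U(1) P U(2)])
  obtain k where "gens_le ?FP P k"
    using FP.gens_le_finite_index[OF UFP _ fin, of u] F.gens_le_restrict[OF P U(2), of u] U(3) by auto
  then have k: "gens_le F P k" using F.gens_le_restrict[OF P order_refl] by simp
  show fg: "finitely_generated ?FP" by (rule F.gens_le_imp_rank(1)[OF P k])
  obtain E :: "('b \<times> 'b word set) set" and h where h: "h \<in> iso (free_group E) ?FP"
    by (rule nielsen_schreier[OF P[unfolded F_def]]) (simp add: F_def)
  let ?FE = "free_group E"
  have E: "finite E" "card E \<le> group_rank ?FP"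
    using free_basis_le_gens[OF F.is_group P h F.gens_le_rank[OF P fg]] by auto
  have hh: "h \<in> hom ?FE ?FP" "h ` carrier ?FE = P" "inj_on h (carrier ?FE)"
    using h by (auto simp: iso_iff)
  let ?W = "{w \<in> carrier ?FE. h w \<in> U}"
  have surj: "h ` carrier ?FE = carrier ?FP" using hh(2) by simp
  obtain E' :: "(('b \<times> 'b word set) \<times> 'b word set) set" and h'
    where "subgroup ?W ?FE" and h': "h' \<in> iso (free_group E') (?FE\<lparr>carrier := ?W\<rparr>)"
      and card: "finite E \<Longrightarrow> finite (rcosets\<^bsub>?FP\<^esub> U) \<Longrightarrow>
        finite E' \<and> card E' + card (rcosets\<^bsub>?FP\<^esub> U) = card E * card (rcosets\<^bsub>?FP\<^esub> U) + 1"
    by (rule preimage_free[OF FP.is_group hh(1) surj UFP]) blast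
  have "h \<circ> h' \<in> iso (free_group E') (?FP\<lparr>carrier := h ` ?W\<rparr>)"
    by (rule iso_onto_image_of_part[OF h' _ hh(1)]) (auto intro: inj_on_subset[OF hh(3)])
  moreover have "h ` ?W = U" using hh(2) U(2) by blast
  ultimately have iso: "h \<circ> h' \<in> iso (free_group E') (F\<lparr>carrier := U\<rparr>)" by simp
  have "gens_le F U (card E')"
    using free_basis_gens_le[OF F.is_group U(1) iso] card[OF E(1) fin] by blast
  then have "group_rank (F\<lparr>carrier := U\<rparr>) \<le> card E'" by (rule F.gens_le_imp_rank(2)[OF U(1)])
  moreover have "card E * card (rcosets\<^bsub>?FP\<^esub> U) \<le> card (rcosets\<^bsub>?FP\<^esub> U) * group_rank ?FP"
    using E(2) by (simp add: mult.commute)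
  ultimately show "group_rank (F\<lparr>carrier := U\<rparr>) + card (rcosets\<^bsub>?FP\<^esub> U)
       \<le> card (rcosets\<^bsub>?FP\<^esub> U) * group_rank ?FP + 1"
    using card[OF E(1) fin] by linarith
qed

text \<open>Modulo \<open>L\<close>, the exponent of each generator may be reduced to a bounded range.\<close>

lemma (in comm_group) finite_index_if_torsion:
  assumes L: "subgroup L G" and gens: "gens_le G (carrier G) k"
    and tors: "\<And>c. c \<in> carrier G \<Longrightarrow> \<exists>n::nat. 0 < n \<and> c [^] n \<in> L"
  shows "finite (rcosets L)"
proof -
  have Lc: "L \<subseteq> carrier G" by (rule subgroup.subset[OF L])
  have main: "\<exists>R. finite R \<and> R \<subseteq> carrier G \<and> generate G S \<subseteq> (\<Union>r\<in>R. L #> r)"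
    if "finite S" "S \<subseteq> carrier G" for S
    using that
  proof (induction S rule: finite_induct)
    case empty
    have "\<one> \<in> L #> \<one>" using rcos_self[OF one_closed L] .
    then show ?case using generate_empty by (intro exI[of _ "{\<one>}"]) simp
  next
    case (insert a S)
    then have a: "a \<in> carrier G" and S: "S \<subseteq> carrier G" by auto
    obtain R where R: "finite R" "R \<subseteq> carrier G" "generate G S \<subseteq> (\<Union>r\<in>R. L #> r)"
      using insert.IH S by blast
    obtain n :: nat where n: "0 < n" "a [^] n \<in> L" using tors[OF a] by blast
    let ?R = "(\<lambda>(i, r). a [^] (i::int) \<otimes> r) ` ({0..<int n} \<times> R)"
    have "generate G (insert a S) \<subseteq> (\<Union>r\<in>?R. L #> r)"
    proof
      fix x assume "x \<in> generate G (insert a S)"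
      then obtain q t where x: "x = a [^] (q::int) \<otimes> t" "t \<in> generate G S"
        unfolding generate_insert[OF a S] by blast
      then obtain r l where r: "r \<in> R" "l \<in> L" "t = l \<otimes> r"
        using R(3) by (auto simp: r_coset_def)
      let ?l = "(a [^] int n) [^] (q div int n)"
      have l: "?l \<in> L" using subgroup_int_pow_closed[OF L] n(2) by (simp add: int_pow_int)
      have "a [^] q = ?l \<otimes> a [^] (q mod int n)"
        using a by (simp add: int_pow_pow int_pow_mult[symmetric])
      then have "x = (?l \<otimes> l) \<otimes> (a [^] (q mod int n) \<otimes> r)"
        using x r a l Lc R(2) by (simp add: m_ac subset_iff)
      moreover have "?l \<otimes> l \<in> L" using l r(2) L by (simp add: subgroup.m_closed)
      moreover have "a [^] (q mod int n) \<otimes> r \<in> ?R" using n(1) r(1) by (auto intro!: image_eqI[of _ _ "(q mod int n, r)"])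
      ultimately show "x \<in> (\<Union>r\<in>?R. L #> r)" unfolding r_coset_def by blast
    qed
    moreover have "?R \<subseteq> carrier G" using a R(2) by auto
    moreover have "finite ?R" using R(1) by simp
    ultimately show ?case by (intro exI[of _ ?R]) simp
  qed
  obtain S where S: "finite S" "S \<subseteq> carrier G" "generate G S = carrier G"
    using gens by (auto simp: gens_le_def)
  obtain R where R: "finite R" "R \<subseteq> carrier G" "carrier G \<subseteq> (\<Union>r\<in>R. L #> r)"
    using main[OF S(1,2)] S(3) by auto
  have "rcosets L \<subseteq> (\<lambda>r. L #> r) ` R"
  proof
    fix c assume "c \<in> rcosets L"
    then obtain x where x: "x \<in> carrier G" "c = L #> x" by (auto simp: RCOSETS_def)
    then obtain r where r: "r \<in> R" "x \<in> L #> r" using R(3) by auto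
    then have "c = L #> r" using repr_independence[OF r(2) _ L] R(2) x(2) by auto
    then show "c \<in> (\<lambda>r. L #> r) ` R" using r(1) by simp
  qed
  then show ?thesis using R(1) finite_surj by blast
qed

section \<open>Degrees of inertia in central extensions of free groups\<close>

lemma inertia_quotient_le_1: "0 \<le> a \<Longrightarrow> a \<le> b \<Longrightarrow> inertia_quotient a b \<le> 1"
  by (cases "b = 0") (auto simp: inertia_quotient_def one_ereal_def)

lemma (in group) rank_trivial: "group_rank (G\<lparr>carrier := {\<one>}\<rparr>) = 0"
  "finitely_generated (G\<lparr>carrier := {\<one>}\<rparr>)"
proof -
  have "gens_le G {\<one>} 0" by (rule gens_leI[of "{}"]) (simp_all add: generate_empty)
  from gens_le_imp_rank[OF triv_subgroup this]
  show "group_rank (G\<lparr>carrier := {\<one>}\<rparr>) = 0" "finitely_generated (G\<lparr>carrier := {\<one>}\<rparr>)" by auto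
qed

lemma (in group) inertia_quotient_le_degree:
  assumes "subgroup K G" "finitely_generated (G\<lparr>carrier := K\<rparr>)"
    "finitely_generated (G\<lparr>carrier := H \<inter> K\<rparr>)"
  shows "inertia_quotient (reduced_rank (G\<lparr>carrier := H \<inter> K\<rparr>)) (reduced_rank (G\<lparr>carrier := K\<rparr>))
    \<le> degree_of_inertia G H"
  unfolding degree_of_inertia_def by (rule SUP_upper) (use assms in simp)

text \<open>The trivial subgroup contributes the quotient \<open>0 / 0\<close>, which is \<open>1\<close> by convention.\<close>

lemma (in group) one_le_degree_of_inertia:
  assumes "subgroup H G" shows "1 \<le> degree_of_inertia G H"
proof -
  have "H \<inter> {\<one>} = {\<one>}" using subgroup.one_closed[OF assms] by auto
  then show ?thesis
    using inertia_quotient_le_degree[OF triv_subgroup, of H] rank_trivial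
    by (simp add: inertia_quotient_def reduced_rank_def)
qed

context central_extension_of_free
begin

abbreviation rk :: "'a set \<Rightarrow> nat" where "rk K \<equiv> group_rank (G\<lparr>carrier := K\<rparr>)"
abbreviation rkF :: "'b word set \<Rightarrow> nat" where "rkF P \<equiv> group_rank (F\<lparr>carrier := P\<rparr>)"
abbreviation fg :: "'a set \<Rightarrow> bool" where "fg K \<equiv> finitely_generated (G\<lparr>carrier := K\<rparr>)"
abbreviation fgF :: "'b word set \<Rightarrow> bool" where "fgF P \<equiv> finitely_generated (F\<lparr>carrier := P\<rparr>)"

lemma subgroup_pi: "subgroup K G \<Longrightarrow> subgroup (pi ` K) F"
  by (rule pi.subgroup_img_is_subgroup)

lemma rank_ge:
  assumes K: "subgroup K G" and fg: "fg K"
  shows "fg (kernel_part K)" "fgF (pi ` K)" "rk (kernel_part K) + rkF (pi ` K) \<le> rk K"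
proof -
  obtain k r where kr: "gens_le G (kernel_part K) k" "gens_le F (pi ` K) r" "k + r \<le> rk K"
    using rank_splits[OF K gens_le_rank[OF K fg]] by blast
  note 1 = gens_le_imp_rank[OF subgroup_kernel_part[OF K] kr(1)]
  note 2 = group.gens_le_imp_rank[OF group_free_group subgroup_pi[OF K] kr(2)]
  show "fg (kernel_part K)" "fgF (pi ` K)" using 1 2 by auto
  show "rk (kernel_part K) + rkF (pi ` K) \<le> rk K" using 1(2) 2(2) kr(3) by linarith
qed

text \<open>The part of \<open>M\<close> in the kernel is a subgroup of that of \<open>K\<close>, and these groups are commutative. Only the
  image of \<open>M\<close> can need more generators than that of \<open>K\<close>.\<close>

lemma rank_le:
  assumes K: "subgroup K G" "fg K" and M: "subgroup M G" "M \<subseteq> K" and r: "gens_le F (pi ` M) r"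
  shows "rk M \<le> rk (kernel_part K) + r"
proof -
  have "gens_le G (kernel_part K) (rk (kernel_part K))"
    by (rule gens_le_rank[OF subgroup_kernel_part[OF K(1)] rank_ge(1)[OF K]])
  then have "gens_le G (kernel_part M) (rk (kernel_part K))"
    by (rule kernel_part_gens_mono[OF K(1) _ M])
  then have "gens_le G M (rk (kernel_part K) + r)"
    unfolding kernel_part_def by (rule pi.gens_le_extension[OF M(1) _ r])
  then show ?thesis by (rule gens_le_imp_rank(2)[OF M(1)])
qed

text \<open>The hypothesis on \<open>P\<close> makes the image of \<open>M\<close> cyclic, so it needs no more generators than the image
  of \<open>K\<close>, unless the latter is trivial; but then so is the image of \<open>M\<close>.\<close>

lemma rank_mono_if_cyclic:
  assumes K: "subgroup K G" "fg K" and M: "subgroup M G" "M \<subseteq> K"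
    and P: "subgroup P F" "gens_le F P 1" "pi ` M \<subseteq> P"
  shows "rk M \<le> rk K"
proof -
  have "gens_le F (pi ` M) (rkF (pi ` K))"
  proof (cases "rkF (pi ` K) = 0")
    case True
    then have "gens_le F (pi ` K) 0"
      using group.gens_le_rank[OF group_free_group subgroup_pi[OF K(1)] rank_ge(2)[OF K]] by simp
    then show ?thesis
      using group.gens_le_cyclic_subgroup[OF group_free_group subgroup_pi[OF K(1)] _ _ subgroup_pi[OF M(1)]]
        M(2) True by auto
  next
    case False
    have "gens_le F (pi ` M) 1"
      by (rule group.gens_le_cyclic_subgroup[OF group_free_group P(1,2) order_refl subgroup_pi[OF M(1)] P(3)])
    then show ?thesis using False by (elim gens_le_mono) simp
  qed
  then show ?thesis using rank_le[OF K M] rank_ge(3)[OF K] by fastforce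
qed

text \<open>An element \<open>p\<close> of \<open>pi ` H \<inter> pi ` K\<close> has a lift \<open>a p\<close> in \<open>H\<close> and a lift \<open>b p\<close> in \<open>K\<close>, which differ by a
  central element \<open>c p\<close>. If \<open>c p\<close> and \<open>c p'\<close> agree up to an element \<open>l\<close> of \<open>H\<close>, the lifts of \<open>p\<close> divided by
  \<open>p'\<close> to \<open>H\<close> and to \<open>K\<close> can be made equal, so that the quotient comes from \<open>H \<inter> K\<close>. Hence there are no
  more cosets of the image of \<open>H \<inter> K\<close> than of \<open>kernel_part H\<close>.\<close>

lemma index_image_le:
  assumes H: "subgroup H G" and K: "subgroup K G"
    and fin: "finite (rcosets\<^bsub>G\<lparr>carrier := C\<rparr>\<^esub> (kernel_part H))"
  defines "Q \<equiv> F\<lparr>carrier := pi ` H \<inter> pi ` K\<rparr>"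
  shows "finite (rcosets\<^bsub>Q\<^esub> (pi ` (H \<inter> K)))"
    "card (rcosets\<^bsub>Q\<^esub> (pi ` (H \<inter> K))) \<le> card (rcosets\<^bsub>G\<lparr>carrier := C\<rparr>\<^esub> (kernel_part H))"
proof -
  let ?U = "pi ` (H \<inter> K)" and ?GC = "G\<lparr>carrier := C\<rparr>"
  note Hc = subgroup.mem_carrier[OF H] and Kc = subgroup.mem_carrier[OF K]
  have HK: "subgroup (H \<inter> K) G" by (rule subgroups_Inter_pair[OF H K])
  have P: "subgroup (pi ` H \<inter> pi ` K) F"
    by (rule pi.H.subgroups_Inter_pair[OF subgroup_pi[OF H] subgroup_pi[OF K]])
  have U: "subgroup ?U Q" unfolding Q_def
    by (rule pi.H.subgroup_incl[OF subgroup_pi[OF HK] P]) auto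
  interpret Q: group Q unfolding Q_def by (rule pi.H.subgroup_imp_group[OF P])
  have carQ: "carrier Q = pi ` H \<inter> pi ` K" by (simp add: Q_def)
  have "\<exists>a b. a \<in> H \<and> b \<in> K \<and> pi a = p \<and> pi b = p" if "p \<in> carrier Q" for p
  proof -
    have "p \<in> pi ` H" "p \<in> pi ` K" using that carQ by auto
    then obtain x y where "x \<in> H" "p = pi x" "y \<in> K" "p = pi y" by blast
    then show ?thesis by auto
  qed
  then obtain a b where a: "\<And>p. p \<in> carrier Q \<Longrightarrow> a p \<in> H" "\<And>p. p \<in> carrier Q \<Longrightarrow> pi (a p) = p"
    and b: "\<And>p. p \<in> carrier Q \<Longrightarrow> b p \<in> K" "\<And>p. p \<in> carrier Q \<Longrightarrow> pi (b p) = p"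
    by metis
  define c where "c p = a p \<otimes> inv (b p)" for p
  have c: "c p \<in> C" if p: "p \<in> carrier Q" for p
    using a[OF p] b[OF p] Hc[OF a(1)[OF p]] Kc[OF b(1)[OF p]] p carQ
      subgroup.mem_carrier[OF P, of p] by (simp add: c_def kernel_part_def)
  let ?g = "\<lambda>p. kernel_part H #>\<^bsub>?GC\<^esub> c p"
  interpret GC: group ?GC by (rule subgroup_imp_group[OF subgroup_C])
  have L: "subgroup (kernel_part H) ?GC"
    by (rule subgroup_incl[OF subgroup_kernel_part[OF H] subgroup_C kernel_part_subset[OF H]])
  have same: "?U #>\<^bsub>Q\<^esub> p = ?U #>\<^bsub>Q\<^esub> p'"
    if p: "p \<in> carrier Q" and p': "p' \<in> carrier Q" and eq: "?g p = ?g p'" for p p'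
  proof -
    have "c p \<in> ?g p'" using GC.rcos_self[OF _ L, of "c p"] c[OF p] eq by simp
    then obtain l where l: "l \<in> kernel_part H" "c p = l \<otimes> c p'" by (auto simp: r_coset_def)
    have car: "a p \<in> carrier G" "b p \<in> carrier G" "a p' \<in> carrier G" "b p' \<in> carrier G"
      "l \<in> carrier G" "c p' \<in> carrier G" "l \<in> H" "pi l = \<one>\<^bsub>F\<^esub>"
      using a b p p' Hc Kc l c by (auto simp: kernel_part_def)
    let ?x = "inv l \<otimes> (a p \<otimes> inv (a p'))" and ?y = "b p \<otimes> inv (b p')"
    have ap: "a p = l \<otimes> (c p' \<otimes> b p)"
      using l(2) car by (metis c_def inv_solve_right m_assoc m_closed)
    have ap': "a p' = c p' \<otimes> b p'" using car by (simp add: c_def m_assoc)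
    have "a p = l \<otimes> (b p \<otimes> c p')"
      using ap central[of "c p'" "b p"] c[OF p'] car by (simp add: kernel_part_def)
    then have "?x = b p \<otimes> (c p' \<otimes> inv (c p' \<otimes> b p'))"
      using car ap' by (simp add: m_assoc[symmetric])
    also have "\<dots> = b p \<otimes> (c p' \<otimes> inv (b p' \<otimes> c p'))"
      using central[of "c p'" "b p'"] c[OF p'] car by (simp add: kernel_part_def)
    also have "\<dots> = ?y"
      using car by (simp add: inv_mult_group m_assoc[symmetric])
    finally have xy: "?x = ?y" .
    have "?x \<in> H" using a p p' car H by (simp add: subgroup.m_closed subgroup.m_inv_closed)
    moreover have "?y \<in> K" using b p p' K by (simp add: subgroup.m_closed subgroup.m_inv_closed)
    ultimately have "pi ?y \<in> ?U" using xy by auto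
    moreover have "pi ?y = p \<otimes>\<^bsub>F\<^esub> inv\<^bsub>F\<^esub> p'" using b p p' car by simp
    moreover have "inv\<^bsub>Q\<^esub> p' = inv\<^bsub>F\<^esub> p'"
      unfolding Q_def by (rule pi.H.m_inv_consistent[OF P]) (use p' carQ in simp)
    ultimately have "p \<otimes>\<^bsub>Q\<^esub> inv\<^bsub>Q\<^esub> p' \<in> ?U" by (simp add: Q_def)
    then have "p \<otimes>\<^bsub>Q\<^esub> inv\<^bsub>Q\<^esub> p' \<otimes>\<^bsub>Q\<^esub> p' \<in> ?U #>\<^bsub>Q\<^esub> p'"
      by (intro Q.rcosI subgroup.subset[OF U] p')
    then have "p \<in> ?U #>\<^bsub>Q\<^esub> p'" using p p' by (simp add: Q.m_assoc)
    then show ?thesis using Q.repr_independence[OF _ p' U] by metis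
  qed
  define r where "r D = (SOME p. p \<in> carrier Q \<and> D = ?U #>\<^bsub>Q\<^esub> p)" for D
  have r: "r D \<in> carrier Q" "D = ?U #>\<^bsub>Q\<^esub> r D" if "D \<in> rcosets\<^bsub>Q\<^esub> ?U" for D
  proof -
    have "\<exists>p. p \<in> carrier Q \<and> D = ?U #>\<^bsub>Q\<^esub> p" using that by (auto simp: RCOSETS_def)
    from someI_ex[OF this] show "r D \<in> carrier Q" "D = ?U #>\<^bsub>Q\<^esub> r D" by (simp_all add: r_def)
  qed
  have inj: "inj_on (\<lambda>D. ?g (r D)) (rcosets\<^bsub>Q\<^esub> ?U)"
  proof (rule inj_onI)
    fix D D' assume D: "D \<in> rcosets\<^bsub>Q\<^esub> ?U" "D' \<in> rcosets\<^bsub>Q\<^esub> ?U" "?g (r D) = ?g (r D')"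
    have "?U #>\<^bsub>Q\<^esub> r D = ?U #>\<^bsub>Q\<^esub> r D'" by (rule same[OF r(1)[OF D(1)] r(1)[OF D(2)] D(3)])
    then show "D = D'" using r(2)[OF D(1)] r(2)[OF D(2)] by simp
  qed
  have sub: "(\<lambda>D. ?g (r D)) ` (rcosets\<^bsub>Q\<^esub> ?U) \<subseteq> rcosets\<^bsub>?GC\<^esub> (kernel_part H)"
  proof
    fix y assume "y \<in> (\<lambda>D. ?g (r D)) ` (rcosets\<^bsub>Q\<^esub> ?U)"
    then obtain D where "D \<in> rcosets\<^bsub>Q\<^esub> ?U" "y = ?g (r D)" by blast
    then show "y \<in> rcosets\<^bsub>?GC\<^esub> (kernel_part H)"
      using GC.rcosetsI[OF subgroup.subset[OF L], of "c (r D)"] c r(1) by simp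
  qed
  show "finite (rcosets\<^bsub>Q\<^esub> ?U)" by (rule inj_on_finite[OF inj sub fin])
  show "card (rcosets\<^bsub>Q\<^esub> ?U) \<le> card (rcosets\<^bsub>?GC\<^esub> (kernel_part H))"
    by (rule card_inj_on_le[OF inj sub fin])
qed

lemma degree_of_inertia_cyclic_image:
  assumes H: "subgroup H G" and P: "gens_le F (pi ` H) 1"
  shows "degree_of_inertia G H = 1"
proof (rule antisym)
  show "1 \<le> degree_of_inertia G H" by (rule one_le_degree_of_inertia[OF H])
  show "degree_of_inertia G H \<le> 1"
    unfolding degree_of_inertia_def
  proof (rule SUP_least)
    fix K assume "K \<in> {K. subgroup K G \<and> fg K \<and> fg (H \<inter> K)}"
    then have K: "subgroup K G" "fg K" by auto
    have "rk (H \<inter> K) \<le> rk K"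
      by (rule rank_mono_if_cyclic[OF K subgroups_Inter_pair[OF H K(1)] _ subgroup_pi[OF H] P]) auto
    then show "inertia_quotient (reduced_rank (G\<lparr>carrier := H \<inter> K\<rparr>)) (reduced_rank (G\<lparr>carrier := K\<rparr>)) \<le> 1"
      by (intro inertia_quotient_le_1) (auto simp: reduced_rank_def)
  qed
qed

text \<open>Write \<open>k\<close> for the rank of the kernel part of \<open>K\<close>, \<open>p\<close> for the rank of its image and \<open>\<delta>\<close> for the degree of
  inertia of the image of \<open>H\<close>. If \<open>p \<ge> 2\<close>, the reduced rank of \<open>K\<close> is at least \<open>k + (p - 1)\<close>, and that of
  \<open>H \<inter> K\<close> is at most \<open>k + l \<delta> (p - 1)\<close>, which is at most \<open>l \<delta>\<close> times the former since \<open>l \<delta> \<ge> 1\<close>. If \<open>p \<le> 1\<close>,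
  the rank of \<open>H \<inter> K\<close> does not exceed that of \<open>K\<close>.\<close>

lemma inertia_quotient_le_index_mult:
  assumes H: "subgroup H G" and K: "subgroup K G" "fg K" "fg (H \<inter> K)"
    and fin: "finite (rcosets\<^bsub>G\<lparr>carrier := C\<rparr>\<^esub> (kernel_part H))"
    and l: "l = card (rcosets\<^bsub>G\<lparr>carrier := C\<rparr>\<^esub> (kernel_part H))"
  shows "inertia_quotient (reduced_rank (G\<lparr>carrier := H \<inter> K\<rparr>)) (reduced_rank (G\<lparr>carrier := K\<rparr>))
    \<le> ereal (real l) * degree_of_inertia F (pi ` H)" (is "_ \<le> _ * ?d")
proof -
  have HK: "subgroup (H \<inter> K) G" by (rule subgroups_Inter_pair[OF H K(1)])
  have "kernel_part H \<in> rcosets\<^bsub>G\<lparr>carrier := C\<rparr>\<^esub> (kernel_part H)"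
    by (intro subgroup.subgroup_in_rcosets subgroup_incl subgroup_kernel_part H subgroup_C
        kernel_part_subset subgroup_imp_group)
  then have l1: "1 \<le> l" using fin l by (metis One_nat_def Suc_leI card_gt_0_iff empty_iff)
  have d1: "1 \<le> ?d"
    by (rule group.one_le_degree_of_inertia[OF group_free_group subgroup_pi[OF H]])
  have ld1: "1 \<le> ereal (real l) * ?d"
  proof -
    have "1 * 1 \<le> ereal (real l) * ?d"
      using l1 d1 by (intro ereal_mult_mono) (auto simp: one_ereal_def)
    then show ?thesis by simp
  qed
  show ?thesis
  proof (cases "rkF (pi ` K) \<le> 1")
    case True
    have "gens_le F (pi ` K) 1"
      using group.gens_le_rank[OF group_free_group subgroup_pi[OF K(1)] rank_ge(2)[OF K(1,2)]] True
      by (rule gens_le_mono)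
    then have "rk (H \<inter> K) \<le> rk K"
      by (intro rank_mono_if_cyclic[OF K(1,2) HK _ subgroup_pi[OF K(1)]]) auto
    then have "inertia_quotient (reduced_rank (G\<lparr>carrier := H \<inter> K\<rparr>)) (reduced_rank (G\<lparr>carrier := K\<rparr>)) \<le> 1"
      by (intro inertia_quotient_le_1) (auto simp: reduced_rank_def)
    then show ?thesis using ld1 by (rule order_trans)
  next
    case p: False
    let ?P = "pi ` H \<inter> pi ` K" and ?U = "pi ` (H \<inter> K)"
    let ?j = "card (rcosets\<^bsub>F\<lparr>carrier := ?P\<rparr>\<^esub> ?U)"
    let ?k = "rk (kernel_part K)" and ?p = "rkF (pi ` K)"
    have P: "subgroup ?P F"
      by (rule pi.H.subgroups_Inter_pair[OF subgroup_pi[OF H] subgroup_pi[OF K(1)]])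
    note idx = index_image_le[OF H K(1) fin]
    have U: "gens_le F ?U (rkF ?U)"
      by (rule group.gens_le_rank[OF group_free_group subgroup_pi[OF HK] rank_ge(2)[OF HK K(3)]])
    have UP: "?U \<subseteq> ?P" by auto
    have PU: "fgF ?P" "rkF ?U + ?j \<le> ?j * rkF ?P + 1"
      using schreier_rank_bound[OF P subgroup_pi[OF HK] UP U idx(1)] by auto
    have jl: "?j \<le> l" using idx(2) l by simp
    have M: "rk (H \<inter> K) \<le> ?k + rkF ?U"
      by (rule rank_le[OF K(1,2) HK _ U]) auto
    have Kge: "?k + ?p \<le> rk K" by (rule rank_ge(3)[OF K(1,2)])
    have rrK: "reduced_rank (G\<lparr>carrier := K\<rparr>) = real (rk K) - 1"
      using Kge p by (simp add: reduced_rank_def)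
    have b: "real (rk K) - 1 \<ge> real ?k + (real ?p - 1)" "real ?p - 1 \<ge> 1"
      using Kge p by linarith+
    define rP where "rP = reduced_rank (F\<lparr>carrier := ?P\<rparr>)"
    have rP0: "0 \<le> rP" by (simp add: rP_def reduced_rank_def)
    have rP: "real (rkF ?P) - 1 \<le> rP" by (simp add: rP_def reduced_rank_def)
    have dq: "ereal (rP / (real ?p - 1)) \<le> ?d"
    proof -
      have "reduced_rank (F\<lparr>carrier := pi ` K\<rparr>) = real ?p - 1" using p by (simp add: reduced_rank_def)
      then have "ereal (rP / (real ?p - 1))
          = inertia_quotient rP (reduced_rank (F\<lparr>carrier := pi ` K\<rparr>))"
        using b(2) by (simp add: inertia_quotient_def)
      also have "\<dots> \<le> ?d" unfolding rP_def
        by (rule group.inertia_quotient_le_degree[OF group_free_group subgroup_pi[OF K(1)] rank_ge(2)[OF K(1,2)] PU(1)])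
      finally show ?thesis .
    qed
    show ?thesis
    proof (cases ?d)
      case (real \<delta>)
      have \<delta>: "1 \<le> \<delta>" using d1 real by (simp add: one_ereal_def)
      have rP\<delta>: "rP \<le> \<delta> * (real ?p - 1)"
        using dq b(2) real by (simp add: pos_divide_le_eq)
      have l\<delta>: "1 \<le> real l * \<delta>" using l1 \<delta> mult_mono[of 1 "real l" 1 \<delta>] by simp
      have "real (rkF ?U) + real ?j \<le> real ?j * real (rkF ?P) + 1"
      proof -
        have "real (rkF ?U + ?j) \<le> real (?j * rkF ?P + 1)" using PU(2) by (simp only: of_nat_le_iff)
        then show ?thesis by simp
      qed
      then have "real (rkF ?U) - 1 \<le> real ?j * (real (rkF ?P) - 1)" by (simp add: algebra_simps)
      also have "\<dots> \<le> real ?j * rP" using rP by (intro mult_left_mono) simp_all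
      also have "\<dots> \<le> real l * rP" using jl rP0 by (intro mult_right_mono) simp_all
      also have "\<dots> \<le> real l * (\<delta> * (real ?p - 1))" using rP\<delta> by (intro mult_left_mono) simp_all
      finally have u: "real (rkF ?U) - 1 \<le> (real l * \<delta>) * (real ?p - 1)" by (simp add: mult.assoc)
      have "real (rk (H \<inter> K)) - 1 \<le> real ?k + (real (rkF ?U) - 1)" using M by linarith
      also have "\<dots> \<le> (real l * \<delta>) * real ?k + (real l * \<delta>) * (real ?p - 1)"
        using u mult_right_mono[OF l\<delta>, of "real ?k"] by simp
      also have "\<dots> = (real l * \<delta>) * (real ?k + (real ?p - 1))" by (simp add: algebra_simps)
      also have "\<dots> \<le> (real l * \<delta>) * (real (rk K) - 1)"
        using b(1) l\<delta> by (intro mult_left_mono) simp_all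
      finally have main: "real (rk (H \<inter> K)) - 1 \<le> (real l * \<delta>) * (real (rk K) - 1)" .
      have bpos: "0 < real (rk K) - 1" using b by linarith
      have "reduced_rank (G\<lparr>carrier := H \<inter> K\<rparr>) \<le> (real l * \<delta>) * (real (rk K) - 1)"
        using main bpos l\<delta> by (simp add: reduced_rank_def)
      then have "reduced_rank (G\<lparr>carrier := H \<inter> K\<rparr>) / (real (rk K) - 1) \<le> real l * \<delta>"
        using bpos by (simp add: pos_divide_le_eq)
      moreover have "inertia_quotient (reduced_rank (G\<lparr>carrier := H \<inter> K\<rparr>)) (reduced_rank (G\<lparr>carrier := K\<rparr>))
        = ereal (reduced_rank (G\<lparr>carrier := H \<inter> K\<rparr>) / (real (rk K) - 1))"
        using bpos unfolding rrK by (simp add: inertia_quotient_def)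
      ultimately show ?thesis unfolding real by simp
    next
      case PInf
      then show ?thesis using l1 by simp
    next
      case MInf
      then show ?thesis using d1 by (simp add: one_ereal_def)
    qed
  qed
qed

text \<open>The subgroup \<open>K\<close> is a copy of the image of \<open>H\<close>, twisted by powers of \<open>t\<close>, together with \<open>t\<close> to the power
  \<open>N\<close>. Since only the trivial power of \<open>t\<close> lies in \<open>H\<close>, an element \<open>sec w\<close> times a power of \<open>t\<close> lies in \<open>H \<inter> K\<close>
  only if this power is trivial, which is possible just when \<open>N\<close> divides \<open>chi w\<close>. These \<open>w\<close> form a subgroup
  of index \<open>N\<close> in a free group of rank at least 2.\<close>

lemma large_intersection:
  fixes E :: "'e set"
  assumes H: "subgroup H G" and h: "h \<in> iso (free_group E) (F\<lparr>carrier := pi ` H\<rparr>)"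
    and E: "finite E" "2 \<le> card E" and t: "t \<in> C" "\<And>n::int. t [^] n \<in> H \<Longrightarrow> n = 0" and N: "0 < (N::nat)"
  shows "\<exists>K. subgroup K G \<and> gens_le G K (card E + 1) \<and> fg (H \<inter> K) \<and> N + 1 \<le> rk (H \<inter> K)"
proof -
  let ?FE = "free_group E" and ?ZN = "integer_mod_group N"
  interpret FE: group ?FE by (rule group_free_group)
  obtain e where e: "e \<in> E" using E(2) by fastforce
  obtain sec where sec: "sec \<in> hom ?FE G" "\<And>w. w \<in> carrier ?FE \<Longrightarrow> sec w \<in> H"
    "\<And>w. w \<in> carrier ?FE \<Longrightarrow> pi (sec w) = h w"
    using section_exists[OF H h] by blast
  interpret sec: group_hom ?FE G sec
    using sec(1) by (simp add: group_hom_def group_hom_axioms_def)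
  have h_inj: "inj_on h (carrier ?FE)" and h_surj: "h ` carrier ?FE = pi ` H" using h by (auto simp: iso_iff)
  have "\<exists>c\<in>hom ?FE integer_group. \<forall>x\<in>E. c [(x, True)] = 1"
    by (rule free_group_extend) auto
  then obtain chi where chi: "chi \<in> hom ?FE integer_group" "\<And>x. x \<in> E \<Longrightarrow> chi [(x, True)] = 1" by blast
  interpret chi: group_hom ?FE integer_group chi
    using chi(1) by (simp add: group_hom_def group_hom_axioms_def)
  have tG: "t \<in> carrier G" "pi t = \<one>\<^bsub>F\<^esub>" using t(1) by (auto simp: kernel_part_def)
  have pit: "pi (t [^] (n::int)) = \<one>\<^bsub>F\<^esub>" for n using tG by (simp add: pi.hom_int_pow)
  have comm: "t [^] (n::int) \<otimes> g = g \<otimes> t [^] n" if "g \<in> carrier G" for n g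
    using central[OF _ pit that] tG by simp
  define K where "K = {sec w \<otimes> t [^] (chi w + c * int N) | w c. w \<in> carrier ?FE}"
  have KI: "sec w \<otimes> t [^] n \<in> K" if "w \<in> carrier ?FE" "n = chi w + c * int N" for w n c
    unfolding K_def using that by blast
  have Kmult: "sec w \<otimes> t [^] n \<otimes> (sec w' \<otimes> t [^] n') = sec (w \<otimes>\<^bsub>?FE\<^esub> w') \<otimes> t [^] (n + n')"
    if "w \<in> carrier ?FE" "w' \<in> carrier ?FE" for w w' and n n' :: int
  proof -
    have "sec w \<otimes> t [^] n \<otimes> (sec w' \<otimes> t [^] n') = sec w \<otimes> (t [^] n \<otimes> sec w') \<otimes> t [^] n'"
      using that tG by (simp add: m_assoc)
    also have "\<dots> = sec w \<otimes> (sec w' \<otimes> t [^] n) \<otimes> t [^] n'"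
      using comm[of "sec w'"] that by simp
    also have "\<dots> = sec (w \<otimes>\<^bsub>?FE\<^esub> w') \<otimes> t [^] (n + n')"
      using that tG by (simp add: m_assoc int_pow_mult)
    finally show ?thesis .
  qed
  have K: "subgroup K G"
  proof (rule subgroupI)
    show "K \<subseteq> carrier G" using tG by (auto simp: K_def)
    show "K \<noteq> {}" using KI[OF FE.one_closed refl] by blast
  next
    fix x assume "x \<in> K"
    then obtain w c where w: "w \<in> carrier ?FE" "x = sec w \<otimes> t [^] (chi w + c * int N)"
      by (auto simp: K_def)
    let ?n = "chi w + c * int N"
    have "sec (inv\<^bsub>?FE\<^esub> w) \<otimes> t [^] (- ?n) \<otimes> x = sec (inv\<^bsub>?FE\<^esub> w \<otimes>\<^bsub>?FE\<^esub> w) \<otimes> t [^] (- ?n + ?n)"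
      unfolding w(2) by (rule Kmult) (use w in simp_all)
    also have "\<dots> = \<one>" using w(1) by (simp del: sec.hom_mult)
    finally have "inv x = sec (inv\<^bsub>?FE\<^esub> w) \<otimes> t [^] (- ?n)"
      using w tG by (intro inv_equality) simp_all
    moreover have "- ?n = chi (inv\<^bsub>?FE\<^esub> w) + (- c) * int N" using w(1) by simp
    ultimately show "inv x \<in> K" using KI[of "inv\<^bsub>?FE\<^esub> w" "- ?n" "- c"] w(1) by simp
  next
    fix x y assume "x \<in> K" "y \<in> K"
    then obtain w c w' c' where w: "w \<in> carrier ?FE" "x = sec w \<otimes> t [^] (chi w + c * int N)"
      "w' \<in> carrier ?FE" "y = sec w' \<otimes> t [^] (chi w' + c' * int N)"
      unfolding K_def by blast
    show "x \<otimes> y \<in> K"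
      unfolding w(2,4) Kmult[OF w(1,3)]
      by (rule KI[of _ _ "c + c'"]) (use w in \<open>simp_all add: algebra_simps\<close>)
  qed
  have pi_elem: "pi (sec w \<otimes> t [^] n) = h w" if "w \<in> carrier ?FE" for w and n :: int
    using that tG pit sec(3)[OF that] pi.hom_closed[OF sec.hom_closed[OF that]] by simp
  have piK: "pi ` K = pi ` H"
  proof
    show "pi ` K \<subseteq> pi ` H"
      using pi_elem h_surj by (auto simp: K_def)
    show "pi ` H \<subseteq> pi ` K"
    proof
      fix p assume "p \<in> pi ` H"
      then obtain w where w: "w \<in> carrier ?FE" "p = h w" using h_surj by blast
      have "sec w \<otimes> t [^] (chi w) \<in> K" by (rule KI[of _ _ 0]) (use w in simp_all)
      then show "p \<in> pi ` K" using pi_elem[OF w(1)] w(2) by (metis imageI)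
    qed
  qed
  have ker_w: "w = \<one>\<^bsub>?FE\<^esub>" if "w \<in> carrier ?FE" "h w = \<one>\<^bsub>F\<^esub>" for w
  proof -
    have "h \<one>\<^bsub>?FE\<^esub> = \<one>\<^bsub>F\<^esub>" using sec(3)[of "\<one>\<^bsub>?FE\<^esub>"] by simp
    then show ?thesis using inj_onD[OF h_inj _ that(1) FE.one_closed] that(2) by simp
  qed
  have "{x \<in> K. pi x = \<one>\<^bsub>F\<^esub>} = generate G {t [^] int N}"
  proof
    have gen: "generate G {t [^] int N} = {(t [^] int N) [^] (c::int) | c. c \<in> UNIV}"
      using tG by (intro generate_pow) simp
    show "{x \<in> K. pi x = \<one>\<^bsub>F\<^esub>} \<subseteq> generate G {t [^] int N}"
    proof
      fix x assume "x \<in> {x \<in> K. pi x = \<one>\<^bsub>F\<^esub>}"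
      then obtain w c where w: "w \<in> carrier ?FE" "x = sec w \<otimes> t [^] (chi w + c * int N)" "pi x = \<one>\<^bsub>F\<^esub>"
        by (auto simp: K_def)
      have "w = \<one>\<^bsub>?FE\<^esub>" using ker_w[OF w(1)] pi_elem[OF w(1)] w(2,3) by simp
      then have "x = (t [^] int N) [^] c" using w(2) tG by (simp add: int_pow_pow mult.commute)
      then show "x \<in> generate G {t [^] int N}" unfolding gen by blast
    qed
    show "generate G {t [^] int N} \<subseteq> {x \<in> K. pi x = \<one>\<^bsub>F\<^esub>}"
    proof
      fix x assume "x \<in> generate G {t [^] int N}"
      then obtain c where c: "x = t [^] (c * int N)"
        unfolding gen using tG by (auto simp: int_pow_pow mult.commute)
      have "sec \<one>\<^bsub>?FE\<^esub> \<otimes> t [^] (c * int N) \<in> K" by (rule KI[of _ _ c]) simp_all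
      then show "x \<in> {x \<in> K. pi x = \<one>\<^bsub>F\<^esub>}" using c pit tG by simp
    qed
  qed
  moreover have "t [^] int N \<in> generate G {t [^] int N}" by (rule generate.incl) simp
  ultimately have "gens_le G {x \<in> K. pi x = \<one>\<^bsub>F\<^esub>} 1" by (intro gens_leI[of "{t [^] int N}"]) simp_all
  moreover have "gens_le F (pi ` K) (card E)"
    unfolding piK by (rule free_basis_gens_le[OF group_free_group subgroup_pi[OF H] h E(1)])
  ultimately have "gens_le G K (1 + card E)" by (rule pi.gens_le_extension[OF K])
  then have gensK: "gens_le G K (card E + 1)" by (simp add: add.commute)
  \<comment> \<open>\<open>H \<inter> K\<close> is the image under \<open>sec\<close> of the kernel of \<open>f\<close>, whose rank is \<open>N (card E - 1) + 1\<close>.\<close>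
  define f where "f w = chi w mod int N" for w
  let ?W = "{w \<in> carrier ?FE. f w \<in> {0}}"
  have f: "f \<in> hom ?FE ?ZN"
    using N by (intro homI) (auto simp: f_def carrier_integer_mod_group mod_add_eq)
  have f_surj: "f ` carrier ?FE = carrier ?ZN"
  proof
    show "f ` carrier ?FE \<subseteq> carrier ?ZN" by (rule hom_carrier[OF f])
    show "carrier ?ZN \<subseteq> f ` carrier ?FE"
    proof
      fix y assume "y \<in> carrier ?ZN"
      then have y: "0 \<le> y" "y < int N" using N by (auto simp: carrier_integer_mod_group)
      have l: "[(e, True)] \<in> carrier ?FE" using e by (simp add: letter_in_free_group)
      have "f ([(e, True)] [^]\<^bsub>?FE\<^esub> y) = y"
        using y chi(2)[OF e] chi.hom_int_pow[OF l, of y] by (simp add: f_def)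
      then show "y \<in> f ` carrier ?FE" using FE.int_pow_closed[OF l, of y] by (metis imageI)
    qed
  qed
  have U: "subgroup {0} ?ZN"
    using group.triv_subgroup[OF group_integer_mod_group[of N]] by simp
  have cosets: "rcosets\<^bsub>?ZN\<^esub> {0} = (\<lambda>y. {y}) ` {0..<int N}"
    using N by (force simp: RCOSETS_def r_coset_def carrier_integer_mod_group)
  have fin: "finite (rcosets\<^bsub>?ZN\<^esub> {0})" and cardN: "card (rcosets\<^bsub>?ZN\<^esub> {0}) = N"
    unfolding cosets by (auto simp: card_image)
  obtain E' :: "('e \<times> int set) set" and h'
    where h': "h' \<in> iso (free_group E') (?FE\<lparr>carrier := ?W\<rparr>)"
      and card: "finite E \<Longrightarrow> finite (rcosets\<^bsub>?ZN\<^esub> {0}) \<Longrightarrow>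
        finite E' \<and> card E' + card (rcosets\<^bsub>?ZN\<^esub> {0}) = card E * card (rcosets\<^bsub>?ZN\<^esub> {0}) + 1"
    by (rule preimage_free[OF group_integer_mod_group f f_surj U]) blast
  have E': "finite E'" "card E' + N = card E * N + 1" using card[OF E(1) fin] cardN by auto
  have "2 * N \<le> card E * N" using E(2) by simp
  then have cardE': "N + 1 \<le> card E'" using E'(2) by linarith
  have "inj_on sec (carrier ?FE)"
    by (rule inj_onI) (metis sec(3) inj_onD[OF h_inj])
  then have "sec \<circ> h' \<in> iso (free_group E') (G\<lparr>carrier := sec ` ?W\<rparr>)"
    by (intro iso_onto_image_of_part[OF h' _ sec(1)]) (auto intro: inj_on_subset)
  moreover have "sec ` ?W = H \<inter> K"
  proof
    show "sec ` ?W \<subseteq> H \<inter> K"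
    proof
      fix x assume "x \<in> sec ` ?W"
      then obtain w where w: "w \<in> carrier ?FE" "chi w mod int N = 0" "x = sec w" by (auto simp: f_def)
      then obtain q where q: "chi w = int N * q" by auto
      have "sec w \<otimes> t [^] (0::int) \<in> K"
        by (rule KI[of _ _ "- q"]) (use w q in simp_all)
      then show "x \<in> H \<inter> K" using w sec(2) by simp
    qed
    show "H \<inter> K \<subseteq> sec ` ?W"
    proof
      fix x assume x: "x \<in> H \<inter> K"
      then obtain w c where w: "w \<in> carrier ?FE" "x = sec w \<otimes> t [^] (chi w + c * int N)"
        by (auto simp: K_def)
      have "t [^] (chi w + c * int N) = inv (sec w) \<otimes> x" using w tG by (simp add: m_assoc[symmetric])
      also have "\<dots> \<in> H" using x sec(2)[OF w(1)] H by (simp add: subgroup.m_closed subgroup.m_inv_closed)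
      finally have "chi w + c * int N = 0" by (rule t(2))
      moreover from this have "chi w = - c * int N" by simp
      then have "f w = 0" by (simp add: f_def)
      ultimately show "x \<in> sec ` ?W" using w by simp
    qed
  qed
  ultimately have iso: "sec \<circ> h' \<in> iso (free_group E') (G\<lparr>carrier := H \<inter> K\<rparr>)" by simp
  have HK: "subgroup (H \<inter> K) G" by (rule subgroups_Inter_pair[OF H K])
  have fgHK: "fg (H \<inter> K)"
    by (rule gens_le_imp_rank(1)[OF HK free_basis_gens_le[OF is_group HK iso E'(1)]])
  have "card E' \<le> rk (H \<inter> K)"
    by (rule free_basis_le_gens(2)[OF is_group HK iso gens_le_rank[OF HK fgHK]])
  then have "N + 1 \<le> rk (H \<inter> K)" using cardE' by linarith
  then show ?thesis using K gensK fgHK by blast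
qed

text \<open>The rank of the intersections in \<open>large_intersection\<close> is unbounded, while that of \<open>K\<close> stays below a
  constant. The element \<open>t\<close> exists because \<open>C\<close> modulo the part of \<open>H\<close> would otherwise be a finitely
  generated commutative torsion group, hence finite.\<close>

lemma degree_of_inertia_infinite_index:
  assumes H: "subgroup H G" "fg H" and r: "2 \<le> rkF (pi ` H)"
    and C: "gens_le G C c" and inf: "infinite (rcosets\<^bsub>G\<lparr>carrier := C\<rparr>\<^esub> (kernel_part H))"
  shows "degree_of_inertia G H = \<infinity>"
proof -
  let ?GC = "G\<lparr>carrier := C\<rparr>"
  interpret GC: comm_group ?GC by (rule comm_group_C)
  have L: "subgroup (kernel_part H) ?GC"
    by (rule subgroup_incl[OF subgroup_kernel_part[OF H(1)] subgroup_C kernel_part_subset[OF H(1)]])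
  have gC: "gens_le ?GC (carrier ?GC) c" using C gens_le_restrict[OF subgroup_C order_refl] by simp
  obtain t where t: "t \<in> C" "\<And>n::nat. 0 < n \<Longrightarrow> t [^]\<^bsub>?GC\<^esub> n \<notin> kernel_part H"
    using GC.finite_index_if_torsion[OF L gC] inf by auto
  have tG: "t \<in> carrier G" "pi t = \<one>\<^bsub>F\<^esub>" using t(1) by (auto simp: kernel_part_def)
  have tn: "t [^] n \<notin> H" if "0 < n" for n :: nat
    using t(2)[OF that] tG by (simp add: nat_pow_consistent[symmetric] kernel_part_def pi.hom_nat_pow)
  have tH: "n = 0" if n: "t [^] (n::int) \<in> H" for n
  proof (rule ccontr)
    assume "n \<noteq> 0"
    have "t [^] (- n) \<in> H" using subgroup.m_inv_closed[OF H(1) n] tG by (simp add: int_pow_neg)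
    then have "t [^] \<bar>n\<bar> \<in> H" using n by (simp add: abs_if)
    then have "t [^] (nat \<bar>n\<bar>) \<in> H" by (metis abs_ge_zero int_nat_eq int_pow_int)
    then show False using tn[of "nat \<bar>n\<bar>"] \<open>n \<noteq> 0\<close> by simp
  qed
  have piH: "subgroup (pi ` H) F" by (rule subgroup_pi[OF H(1)])
  obtain E :: "('b \<times> 'b word set) set" and h where h: "h \<in> iso (free_group E) (F\<lparr>carrier := pi ` H\<rparr>)"
    by (rule nielsen_schreier[OF piH])
  have E: "finite E"
    using free_basis_le_gens(1)[OF group_free_group piH h
        group.gens_le_rank[OF group_free_group piH rank_ge(2)[OF H]]] .
  have E2: "2 \<le> card E"
    using group.gens_le_imp_rank(2)[OF group_free_group piH free_basis_gens_le[OF group_free_group piH h E]] r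
    by linarith
  have "ereal (real N / real (card E)) \<le> degree_of_inertia G H" if N: "0 < N" for N :: nat
  proof -
    obtain K where K: "subgroup K G" "gens_le G K (card E + 1)" "fg (H \<inter> K)" "N + 1 \<le> rk (H \<inter> K)"
      using large_intersection[OF H(1) h E E2 t(1), of N] tH N by blast
    note fgK = gens_le_imp_rank[OF K(1,2)]
    let ?a = "reduced_rank (G\<lparr>carrier := H \<inter> K\<rparr>)" and ?b = "reduced_rank (G\<lparr>carrier := K\<rparr>)"
    have a: "real N \<le> ?a" using K(4) by (simp add: reduced_rank_def)
    have b: "0 \<le> ?b" "?b \<le> real (card E)" using fgK(2) by (simp_all add: reduced_rank_def)
    have "ereal (real N / real (card E)) \<le> inertia_quotient ?a ?b"
    proof (cases "?b = 0")
      case True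
      then have "inertia_quotient ?a ?b = \<infinity>"
        using a N by (simp add: inertia_quotient_def)
      then show ?thesis by simp
    next
      case False
      have "real N / real (card E) \<le> ?a / ?b"
        using a b False by (intro frac_le) simp_all
      then show ?thesis using False by (simp add: inertia_quotient_def)
    qed
    also have "\<dots> \<le> degree_of_inertia G H"
      by (rule inertia_quotient_le_degree[OF K(1) fgK(1) K(3)])
    finally show ?thesis .
  qed
  note large = this
  show ?thesis
  proof (rule ereal_top)
    fix B :: real
    define N where "N = nat \<lceil>\<bar>B\<bar> * real (card E)\<rceil> + 1"
    have "B * real (card E) \<le> \<bar>B\<bar> * real (card E)" by (intro mult_right_mono) simp_all
    also have "\<dots> \<le> real N" unfolding N_def by linarith
    finally have "B \<le> real N / real (card E)" using E2 by (simp add: pos_le_divide_eq)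
    then show "ereal B \<le> degree_of_inertia G H"
      using large[of N] by (metis N_def add_gr_0 ereal_less_eq(3) order_trans zero_less_one)
  qed
qed

end

section \<open>The group \<open>\<int>\<^sup>m \<times> F\<^sub>n\<close>\<close>

lemma group_Z_pow: "group (Z_pow m)"
  unfolding Z_pow_def by (rule product_group) simp

lemma gens_le_Z_pow: "\<exists>k. gens_le (Z_pow m) (carrier (Z_pow m)) k"
proof -
  let ?Z = "Z_pow m"
  interpret group ?Z by (rule group_Z_pow)
  define u :: "nat \<Rightarrow> nat \<Rightarrow> int" where "u i = (\<lambda>j\<in>{..<m}. if j = i then 1 else 0)" for i
  have u: "u i \<in> carrier ?Z" for i by (auto simp: Z_pow_def u_def)
  let ?S = "u ` {..<m}"
  have S: "?S \<subseteq> carrier ?Z" using u by auto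
  note gS = generate_is_subgroup[OF S]
  have pow: "(u i [^]\<^bsub>?Z\<^esub> c) j = c * u i j" if "j < m" for i j and c :: int
  proof -
    have "(\<lambda>x. x j) \<in> hom ?Z integer_group"
      using that by (intro homI) (auto simp: Z_pow_def)
    then have "(u i [^]\<^bsub>?Z\<^esub> c) j = u i j [^]\<^bsub>integer_group\<^esub> c"
      using hom_int_pow[of "\<lambda>x. x j" ?Z integer_group "u i" c] u is_group by simp
    then show ?thesis by (simp add: mult.commute)
  qed
  have "x \<in> generate ?Z ?S" if "j \<le> m" "x \<in> carrier ?Z" "\<And>i. i < m \<Longrightarrow> j \<le> i \<Longrightarrow> x i = 0" for j x
    using that
  proof (induction j arbitrary: x)
    case 0
    then have "x = \<one>\<^bsub>?Z\<^esub>"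
      by (intro ext) (auto simp: Z_pow_def PiE_def extensional_def)
    then show ?case using subgroup.one_closed[OF gS] by simp
  next
    case (Suc j)
    let ?y = "x(j := 0)"
    have j: "j < m" using Suc.prems by simp
    have y: "?y \<in> carrier ?Z"
      using Suc.prems(2) j by (auto simp: Z_pow_def PiE_def extensional_def)
    have "?y \<in> generate ?Z ?S"
    proof (rule Suc.IH[OF _ y])
      show "?y i = 0" if "i < m" "j \<le> i" for i using Suc.prems(3)[OF that(1)] that(2) by simp
    qed (use j in simp)
    moreover have "u j \<in> generate ?Z ?S" using j by (intro generate.incl) simp
    then have "u j [^]\<^bsub>?Z\<^esub> x j \<in> generate ?Z ?S" by (rule subgroup_int_pow_closed[OF gS])
    ultimately have "?y \<otimes>\<^bsub>?Z\<^esub> u j [^]\<^bsub>?Z\<^esub> x j \<in> generate ?Z ?S" by (rule generate.eng)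
    moreover have "x = ?y \<otimes>\<^bsub>?Z\<^esub> u j [^]\<^bsub>?Z\<^esub> x j"
    proof
      fix i
      show "x i = (?y \<otimes>\<^bsub>?Z\<^esub> u j [^]\<^bsub>?Z\<^esub> x j) i"
      proof (cases "i < m")
        case True
        then have "(?y \<otimes>\<^bsub>?Z\<^esub> u j [^]\<^bsub>?Z\<^esub> x j) i = ?y i + (u j [^]\<^bsub>?Z\<^esub> x j) i" by (simp add: Z_pow_def)
        then show ?thesis using pow[OF True, of j "x j"] True by (simp add: u_def)
      next
        case False
        then show ?thesis using Suc.prems(2) by (auto simp: Z_pow_def PiE_def extensional_def)
      qed
    qed
    ultimately show ?case by simp
  qed
  from this[of m] have "carrier ?Z \<subseteq> generate ?Z ?S" by auto
  then have "generate ?Z ?S = carrier ?Z" using generate_incl[OF S] by blast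
  then have "gens_le ?Z (carrier ?Z) (card ?S)" using S by (intro gens_leI[of ?S]) simp_all
  then show ?thesis ..
qed

lemma central_extension_ZF: "central_extension_of_free (ZF m n) {..<n} snd"
proof -
  have ZF: "ZF m n = Z_pow m \<times>\<times> free_group {..<n}" by (simp add: ZF_def Fn_def)
  interpret G: group "ZF m n" unfolding ZF by (intro DirProd_group group_Z_pow group_free_group)
  interpret F: group "free_group {..<n}" by (rule group_free_group)
  have snd: "snd \<in> hom (ZF m n) (free_group {..<n})"
    by (rule homI) (auto simp: ZF mult_DirProd')
  show ?thesis
  proof
    show "snd \<in> hom (ZF m n) (free_group {..<n})" by (rule snd)
    fix z g assume "z \<in> carrier (ZF m n)" "snd z = \<one>\<^bsub>free_group {..<n}\<^esub>" "g \<in> carrier (ZF m n)"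
    then show "z \<otimes>\<^bsub>ZF m n\<^esub> g = g \<otimes>\<^bsub>ZF m n\<^esub> z"
      by (auto simp: ZF mult_DirProd' Z_pow_def add.commute)
  qed
qed

theorem theorem1p10:
  fixes m n :: nat and H L :: "((nat \<Rightarrow> int) \<times> nat word) set"
  assumes "subgroup H (ZF m n)"
    and "finitely_generated (ZF m n\<lparr>carrier := H\<rparr>)"
    and "L = H \<inter> Z_factor m n"
  shows "(group_rank (Fn n\<lparr>carrier := snd ` H\<rparr>) \<le> 1 \<longrightarrow>
            degree_of_inertia (ZF m n) H = 1)
       \<and> (group_rank (Fn n\<lparr>carrier := snd ` H\<rparr>) \<ge> 2 \<and>
          subgroup_index (ZF m n\<lparr>carrier := Z_factor m n\<rparr>) L = \<infinity> \<longrightarrow>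
            degree_of_inertia (ZF m n) H = \<infinity>)
       \<and> (\<forall>l::nat. group_rank (Fn n\<lparr>carrier := snd ` H\<rparr>) \<ge> 2 \<and>
          subgroup_index (ZF m n\<lparr>carrier := Z_factor m n\<rparr>) L = enat l \<longrightarrow>
            degree_of_inertia (ZF m n) H
              \<le> ereal (real l) * degree_of_inertia (Fn n) (snd ` H))"
proof -
  interpret central_extension_of_free "ZF m n" "{..<n}" snd by (rule central_extension_ZF)
  note H = assms(1,2)
  have C: "C = Z_factor m n"
    by (auto simp: kernel_part_def Z_factor_def ZF_def Fn_def)
  have L: "L = kernel_part H"
    using subgroup.subset[OF H(1)] unfolding assms(3) C[symmetric] by (auto simp: kernel_part_def)
  have Fn: "Fn n = F" by (simp add: Fn_def)
  obtain c where c: "gens_le (Z_pow m) (carrier (Z_pow m)) c" using gens_le_Z_pow by blast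
  interpret i: group_hom "Z_pow m" "ZF m n" "\<lambda>z. (z, \<one>\<^bsub>Fn n\<^esub>)"
  proof (intro group_hom.intro group_hom_axioms.intro group_Z_pow is_group homI)
    interpret Z: group "Z_pow m" by (rule group_Z_pow)
    interpret Fn: group "Fn n" unfolding Fn_def by (rule group_free_group)
    show "(x, \<one>\<^bsub>Fn n\<^esub>) \<in> carrier (ZF m n)" if "x \<in> carrier (Z_pow m)" for x
      using that by (simp add: ZF_def)
    show "(x \<otimes>\<^bsub>Z_pow m\<^esub> y, \<one>\<^bsub>Fn n\<^esub>) = (x, \<one>\<^bsub>Fn n\<^esub>) \<otimes>\<^bsub>ZF m n\<^esub> (y, \<one>\<^bsub>Fn n\<^esub>)" for x y
      by (simp add: ZF_def)
  qed
  have "(\<lambda>z. (z, \<one>\<^bsub>Fn n\<^esub>)) ` carrier (Z_pow m) = Z_factor m n" by (auto simp: Z_factor_def)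
  then have gC: "gens_le (ZF m n) C c" using i.gens_le_image[OF c] C by simp
  have piH: "subgroup (snd ` H) F" by (rule subgroup_pi[OF H(1)])
  have "degree_of_inertia (ZF m n) H = 1" if "rkF (snd ` H) \<le> 1"
    using degree_of_inertia_cyclic_image[OF H(1)]
      gens_le_mono[OF group.gens_le_rank[OF group_free_group piH rank_ge(2)[OF H]] that] by simp
  moreover have "degree_of_inertia (ZF m n) H = \<infinity>"
    if "2 \<le> rkF (snd ` H)" "subgroup_index (ZF m n\<lparr>carrier := C\<rparr>) L = \<infinity>"
    using degree_of_inertia_infinite_index[OF H that(1) gC] that(2)
    unfolding L subgroup_index_def by (auto split: if_splits)
  moreover have "degree_of_inertia (ZF m n) H \<le> ereal (real l) * degree_of_inertia F (snd ` H)"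
    if "subgroup_index (ZF m n\<lparr>carrier := C\<rparr>) L = enat l" for l
  proof -
    have fin: "finite (rcosets\<^bsub>ZF m n\<lparr>carrier := C\<rparr>\<^esub> (kernel_part H))"
      and l: "l = card (rcosets\<^bsub>ZF m n\<lparr>carrier := C\<rparr>\<^esub> (kernel_part H))"
      using that unfolding L subgroup_index_def by (auto split: if_splits)
    show ?thesis
      unfolding degree_of_inertia_def[of "ZF m n"]
      by (rule SUP_least) (use inertia_quotient_le_index_mult[OF H(1) _ _ _ fin l] in blast)
  qed
  ultimately show ?thesis unfolding Fn C by blast
qed

end
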